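(* Let $\theta$ be a primitive substitution on a finite alphabet $\mathcal{A}$ and let $u$ be any fixed point of $\theta$. Let $f:\mathcal{A}\to\mathbb{C}$ be a left eigenfunction of the $\theta$-matrix $M$ with eigenvalue $\lambda_f$ satisfying $|\lambda_f|<1$. Let $K_N$ be a random variable with uniform distribution on $\{1,2,\dots,N\}$. For $\mathbf{x}=(v_1,k_1)(v_2,k_2)\cdots\in\mathcal{X}^{*,\infty}$ define $$W_f(\mathbf{x})=\sum_{i=1}^\infty\lambda_f^{\,i-1}S_f(\theta(v_i)_{<k_i}).$$ Then, as $N\to\infty$, $S_f(u_{\le K_N})$ converges in distribution to $W_f(\mathbf{X})$, where $\mathbf{X}$ has distribution $\mathrm{MPM}_\infty$.
   Context: $\mathcal{A}^*$ is the set of finite words over $\mathcal{A}$. A substitution is a map $\theta:\mathcal{A}\to\mathcal{A}^*$, extended to finite words and to $\mathcal{A}^{\mathbb{N}}$ by concatenation. The $\theta$-matrix $M$ has $M_{a,b}$ = number of occurrences of $a$ in $\theta(b)$; $\theta$ is primitive if some power $M^k$, $k>0$, has all entries positive; $\lambda$ is the Perron–Frobenius eigenvalue of $M$. A fixed point of $\theta$ is $u\in\mathcal{A}^{\mathbb{N}}$ with $\theta^k(u)=u$ for some $k\in\mathbb{N}$. For a word or sequence $w$, $w_j$ is its $j$-th letter, $w_{<k}=w_1\cdots w_{k-1}$ (empty for $k=1$), $w_{\le k}=w_1\cdots w_k$. $S_f(a_1\cdots a_k)=f(a_1)+\cdots+f(a_k)$. A left eigenfunction is a nonzero $f$ with $\sum_a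 f(a)M_{a,b}=\lambda_f f(b)$ for all $b$. (Convention $0^0=1$.) State space: $\mathcal{X}=\{(a,j):a\in\mathcal{A},\,1\le j\le|\theta(a)|\}$. Infinite path space: $\mathcal{X}^{*,\infty}$ is the set of sequences $\{(v_i,k_i)\}_{i\ge1}$ in $\mathcal{X}$ with $v_i=\theta(v_{i+1})_{k_{i+1}}$ for all $i\ge1$. Let $Q((a,j),(b,k))=1$ if $a=\theta(b)_k$ and $0$ otherwise. Let $\rho$ be a positive right Perron–Frobenius eigenvector of $M$ and $\hat\rho(b,k)=\rho(b)$. Let $\mathfrak{p}(x,z)=\dfrac{Q(x,z)\hat\rho(z)}{\lambda\hat\rho(x)}$ for $x,z\in\mathcal{X}$ (a stochastic matrix) and $\mathfrak{w}(x)=\hat\rho(x)/\sum_{y\in\mathcal{X}}\hat\rho(y)$. $\mathrm{MPM}_\infty$ is the law on $\mathcal{X}^{*,\infty}$ of the Markov chain with initial distribution $\mathfrak{w}$ and transition matrix $\mathfrak{p}$. *)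

theory Defs
  imports "HOL-Probability.Probability" "HOL-Library.Stream"
begin

section \<open>Substitutions\<close>

text \<open>
  A substitution on the finite alphabet \<^typ>\<open>'a\<close> is a function \<open>\<theta> :: 'a \<Rightarrow> 'a list\<close>. The entry in row
  \<open>a\<close>, column \<open>b\<close> of its matrix is the number of occurrences of \<open>a\<close> in \<open>\<theta> b\<close>; the coefficient
  type is left open since real and complex entries are both needed.
\<close>

definition subst_matrix :: "('a::finite \<Rightarrow> 'a list) \<Rightarrow> 'c::semiring_1 ^ 'a ^ 'a" where
  "subst_matrix \<theta> = (\<chi> a b. of_nat (count_list (\<theta> b) a))"

definition primitive_subst :: "('a::finite \<Rightarrow> 'a list) \<Rightarrow> bool" where
  "primitive_subst \<theta> \<longleftrightarrow>
     (\<exists>k>0. \<forall>a b. 0 < ((((**) (subst_matrix \<theta> :: real ^ 'a ^ 'a)) ^^ k) (mat 1)) $ a $ b)"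

text \<open>
  Infinite words are streams, so the letter with 1-based index \<open>i\<close> is \<open>u !! (i - 1)\<close> and
  \<open>stake k u\<close> is the prefix of length \<open>k\<close>. The concatenation \<^const>\<open>flat\<close> is only meaningful for
  nonempty words; for a primitive \<open>\<theta>\<close> every \<open>\<theta> a\<close> is nonempty.
\<close>

definition subst_stream :: "('a \<Rightarrow> 'a list) \<Rightarrow> 'a stream \<Rightarrow> 'a stream" where
  "subst_stream \<theta> u = flat (smap \<theta> u)"

text \<open>The exponent is positive: with \<open>k = 0\<close> every infinite word would be a fixed point.\<close>

definition fixed_point :: "('a \<Rightarrow> 'a list) \<Rightarrow> 'a stream \<Rightarrow> bool" where
  "fixed_point \<theta> u \<longleftrightarrow> (\<exists>k>0. (subst_stream \<theta> ^^ k) u = u)"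

definition word_sum :: "('a \<Rightarrow> complex) \<Rightarrow> 'a list \<Rightarrow> complex" where
  "word_sum f w = sum_list (map f w)"

definition left_eigenfunction ::
    "('a::finite \<Rightarrow> 'a list) \<Rightarrow> complex \<Rightarrow> ('a \<Rightarrow> complex) \<Rightarrow> bool" where
  "left_eigenfunction \<theta> \<mu> f \<longleftrightarrow>
     (\<exists>a. f a \<noteq> 0) \<and> (\<forall>b. (\<Sum>a\<in>UNIV. f a * subst_matrix \<theta> $ a $ b) = \<mu> * f b)"

text \<open>The Perron-Frobenius eigenvalue is the spectral radius, over all complex eigenvalues.\<close>

definition pf_eigenvalue :: "('a::finite \<Rightarrow> 'a list) \<Rightarrow> real" where
  "pf_eigenvalue \<theta> = Sup {cmod \<mu> | \<mu>. \<exists>v::complex ^ 'a. v \<noteq> 0 \<and> subst_matrix \<theta> *v v = \<mu> *s v}"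

definition pf_right_eigenvector :: "('a::finite \<Rightarrow> 'a list) \<Rightarrow> ('a \<Rightarrow> real) \<Rightarrow> bool" where
  "pf_right_eigenvector \<theta> \<rho> \<longleftrightarrow>
     (\<forall>a. 0 < \<rho> a) \<and> (\<forall>a. (\<Sum>b\<in>UNIV. subst_matrix \<theta> $ a $ b * \<rho> b) = pf_eigenvalue \<theta> * \<rho> a)"


section \<open>The path space and its Markov measure\<close>

text \<open>Positions in a word are 1-based in the states: the \<open>j\<close>-th letter of \<open>w\<close> is \<open>w ! (j - 1)\<close>.\<close>

definition states :: "('a \<Rightarrow> 'a list) \<Rightarrow> ('a \<times> nat) set" where
  "states \<theta> = {(a, j). 1 \<le> j \<and> j \<le> length (\<theta> a)}"

definition path_space :: "('a \<Rightarrow> 'a list) \<Rightarrow> ('a \<times> nat) stream set" where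
  "path_space \<theta> = {x \<in> streams (states \<theta>).
     \<forall>i. fst (x !! i) = \<theta> (fst (x !! Suc i)) ! (snd (x !! Suc i) - 1)}"

definition edge :: "('a \<Rightarrow> 'a list) \<Rightarrow> 'a \<times> nat \<Rightarrow> 'a \<times> nat \<Rightarrow> real" where
  "edge \<theta> x z = (if fst x = \<theta> (fst z) ! (snd z - 1) then 1 else 0)"

definition trans_prob ::
    "('a::finite \<Rightarrow> 'a list) \<Rightarrow> ('a \<Rightarrow> real) \<Rightarrow> 'a \<times> nat \<Rightarrow> 'a \<times> nat \<Rightarrow> real" where
  "trans_prob \<theta> \<rho> x z = edge \<theta> x z * \<rho> (fst z) / (pf_eigenvalue \<theta> * \<rho> (fst x))"

definition init_prob :: "('a::finite \<Rightarrow> 'a list) \<Rightarrow> ('a \<Rightarrow> real) \<Rightarrow> 'a \<times> nat \<Rightarrow> real" where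
  "init_prob \<theta> \<rho> x = \<rho> (fst x) / (\<Sum>y\<in>states \<theta>. \<rho> (fst y))"

text \<open>
  The law of a Markov chain with state space \<open>S\<close>, initial distribution \<open>w\<close> and transition matrix
  \<open>p\<close>, carried by a set \<open>E\<close> of trajectories with the trace of the product sigma-algebra.
\<close>

definition markov_law ::
    "'s stream set \<Rightarrow> 's set \<Rightarrow> ('s \<Rightarrow> real) \<Rightarrow> ('s \<Rightarrow> 's \<Rightarrow> real) \<Rightarrow> 's stream measure \<Rightarrow> bool" where
  "markov_law E S w p N \<longleftrightarrow>
     prob_space N \<and>
     space N = E \<and> sets N = sets (restrict_space (stream_space (count_space UNIV)) E) \<and>
     (\<forall>xs. xs \<noteq> [] \<and> set xs \<subseteq> S \<longrightarrow>
        measure N {x \<in> E. stake (length xs) x = xs} =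
          w (hd xs) * (\<Prod>i<length xs - 1. p (xs ! i) (xs ! Suc i)))"

text \<open>Existence and uniqueness are established in \<open>MPM_ex1\<close> and \<open>markov_law_MPM\<close> below.\<close>

definition MPM :: "('a::finite \<Rightarrow> 'a list) \<Rightarrow> ('a \<Rightarrow> real) \<Rightarrow> ('a \<times> nat) stream measure" where
  "MPM \<theta> \<rho> =
     (THE N. markov_law (path_space \<theta>) (states \<theta>) (init_prob \<theta> \<rho>) (trans_prob \<theta> \<rho>) N)"

text \<open>
  The \<open>i\<close>-th entry of a stream has 1-based index \<open>i + 1\<close>, whence the exponent \<open>i\<close>. The series converges
  absolutely on the path space when \<open>cmod \<mu> < 1\<close>, see \<open>summable_W\<close> below.
\<close>

definition W :: "('a \<Rightarrow> 'a list) \<Rightarrow> ('a \<Rightarrow> complex) \<Rightarrow> complex \<Rightarrow> ('a \<times> nat) stream \<Rightarrow> complex" where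
  "W \<theta> f \<mu> x = (\<Sum>i. \<mu> ^ i * word_sum f (take (snd (x !! i) - 1) (\<theta> (fst (x !! i)))))"


section \<open>Convergence in distribution\<close>

text \<open>The library's \<^const>\<open>weak_conv_m\<close> only covers laws on the real line.\<close>

definition converges_in_distribution ::
    "(nat \<Rightarrow> 'p measure) \<Rightarrow> (nat \<Rightarrow> 'p \<Rightarrow> 'c::metric_space) \<Rightarrow> 'q measure \<Rightarrow> ('q \<Rightarrow> 'c) \<Rightarrow> bool" where
  "converges_in_distribution P Y Q Z \<longleftrightarrow>
     (\<forall>\<^sub>F n in sequentially. Y n \<in> borel_measurable (P n)) \<and> Z \<in> borel_measurable Q \<and>
     (\<forall>g::'c \<Rightarrow> real. continuous_on UNIV g \<and> bounded (range g) \<longrightarrow>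
        (\<lambda>n. \<integral>\<omega>. g (Y n \<omega>) \<partial>P n) \<longlonglongrightarrow> (\<integral>\<omega>. g (Z \<omega>) \<partial>Q))"


section \<open>Well-definedness\<close>

lemma summable_W:
  fixes \<theta> :: "'a::finite \<Rightarrow> 'a list"
  assumes "cmod \<mu> < 1"
  shows "summable (\<lambda>i. norm (\<mu> ^ i * word_sum f (take (snd (x !! i) - 1) (\<theta> (fst (x !! i))))))"
proof -
  define C where "C = (\<Sum>a\<in>UNIV. sum_list (map (\<lambda>c. cmod (f c)) (\<theta> a)))"
  have le1: "cmod (word_sum f (take n w)) \<le> sum_list (map (\<lambda>c. cmod (f c)) w)" for n w
    unfolding word_sum_def
  proof (induction w arbitrary: n)
    case (Cons a w)
    show ?case
    proof (cases n)
      case (Suc m)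
      show ?thesis using Cons[of m] Suc norm_triangle_ineq[of "f a" "sum_list (map f (take m w))"]
        by simp
    qed (use Cons[of 0] in auto)
  qed simp
  have le2: "sum_list (map (\<lambda>c. cmod (f c)) (\<theta> a)) \<le> C" for a
    unfolding C_def by (intro member_le_sum) (auto intro!: sum_list_nonneg)
  show ?thesis
  proof (rule summable_comparison_test')
    show "summable (\<lambda>i. cmod \<mu> ^ i * C)"
      using assms by (intro summable_mult2 summable_geometric) simp
    show "norm (norm (\<mu> ^ i * word_sum f (take (snd (x !! i) - 1) (\<theta> (fst (x !! i))))))
        \<le> cmod \<mu> ^ i * C" if "i \<ge> 0" for i
      using le1 le2 by (auto simp: norm_mult norm_power intro!: mult_left_mono) (meson order_trans)
  qed
qed

primcorec chain :: "'s \<Rightarrow> ('s \<Rightarrow> 's) stream \<Rightarrow> 's stream" where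
  "shd (chain x \<omega>) = x"
| "stl (chain x \<omega>) = chain (shd \<omega> x) (stl \<omega>)"

fun chain_prob :: "('s \<Rightarrow> 's pmf) \<Rightarrow> 's \<Rightarrow> 's list \<Rightarrow> real" where
  "chain_prob k x [] = 1"
| "chain_prob k x (y # ys) = pmf (k x) y * chain_prob k y ys"

lemma chain_prob_eq:
  "chain_prob k x ys = (\<Prod>i<length ys. pmf (k ((x # ys) ! i)) (ys ! i))"
proof (induction ys arbitrary: x)
  case (Cons y ys)
  show ?case unfolding length_Cons prod.lessThan_Suc_shift using Cons by simp
qed simp

lemma chain_snth_Suc: "chain x \<omega> !! Suc n = (\<omega> !! n) (chain x \<omega> !! n)"
  by (induction n arbitrary: x \<omega>) auto

lemma measurable_chain:
  fixes R :: "('s::countable \<Rightarrow> 's) pmf"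
  shows "chain x \<in> stream_space (measure_pmf R) \<rightarrow>\<^sub>M stream_space (count_space UNIV)"
proof (rule measurable_stream_space2)
  fix n
  show "(\<lambda>\<omega>. chain x \<omega> !! n) \<in> stream_space (measure_pmf R) \<rightarrow>\<^sub>M count_space UNIV"
  proof (induction n)
    case (Suc n)
    show ?case unfolding chain_snth_Suc
    proof (rule measurable_compose_countable[OF _ Suc])
      fix i :: 's
      have "(\<lambda>g. g i) \<in> measure_pmf R \<rightarrow>\<^sub>M count_space UNIV"
        by simp
      from measurable_compose[OF measurable_snth this]
      show "(\<lambda>\<omega>. (\<omega> !! n) i) \<in> stream_space (measure_pmf R) \<rightarrow>\<^sub>M count_space UNIV" .
    qed
  qed simp
qed

lemma emeasure_chain:
  fixes k :: "'s::countable \<Rightarrow> 's pmf"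
  assumes S: "finite S" and "x \<in> S" "set ys \<subseteq> S"
  defines "R \<equiv> Pi_pmf S undefined k"
  shows "emeasure (stream_space (measure_pmf R))
     {\<omega> \<in> space (stream_space (measure_pmf R)). stake (length ys) (stl (chain x \<omega>)) = ys}
     = ennreal (chain_prob k x ys)"
  using assms(2,3)
proof (induction ys arbitrary: x)
  interpret R: prob_space "stream_space (measure_pmf R)"
    by (rule prob_space.prob_space_stream_space[OF prob_space_measure_pmf])
  case Nil
  then show ?case using R.emeasure_space_1 by simp
next
  interpret R: prob_space "stream_space (measure_pmf R)"
    by (rule prob_space.prob_space_stream_space[OF prob_space_measure_pmf])
  case (Cons y ys)
  let ?M = "stream_space (measure_pmf R)"
  let ?A = "{\<omega> \<in> space ?M. stake (length (y # ys)) (stl (chain x \<omega>)) = y # ys}"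
  have A: "?A \<in> sets ?M"
  proof -
    have [measurable]: "chain x \<in> ?M \<rightarrow>\<^sub>M stream_space (count_space UNIV)"
      by (rule measurable_chain)
    show ?thesis by measurable
  qed
  have "emeasure ?M ?A = (\<integral>\<^sup>+ g. emeasure ?M {\<omega> \<in> space ?M. g ## \<omega> \<in> ?A} \<partial>R)"
    by (rule prob_space.emeasure_stream_space[OF prob_space_measure_pmf A])
  also have "\<dots> = (\<integral>\<^sup>+ g. ennreal (chain_prob k y ys) * indicator {g. g x = y} g \<partial>R)"
  proof (rule nn_integral_cong)
    fix g
    show "emeasure ?M {\<omega> \<in> space ?M. g ## \<omega> \<in> ?A}
        = ennreal (chain_prob k y ys) * indicator {g. g x = y} g"
    proof (cases "g x = y")
      case True
      then have "{\<omega> \<in> space ?M. g ## \<omega> \<in> ?A} =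
          {\<omega> \<in> space ?M. stake (length ys) (stl (chain y \<omega>)) = ys}"
        by (auto simp: space_stream_space)
      with True Cons show ?thesis by simp
    next
      case False
      then have "{\<omega> \<in> space ?M. g ## \<omega> \<in> ?A} = {}" by auto
      with False show ?thesis by (simp only:) simp
    qed
  qed
  also have "\<dots> = ennreal (chain_prob k y ys) * emeasure R {g. g x = y}"
    by (simp add: nn_integral_cmult)
  also have "emeasure R {g. g x = y} = pmf (k x) y"
  proof -
    have "pmf (k x) y = pmf (map_pmf (\<lambda>g. g x) R) y"
      using Pi_pmf_component[OF S, of x undefined k] Cons.prems unfolding R_def by simp
    also have "\<dots> = measure R {g. g x = y}"
      by (simp add: pmf_map vimage_def)
    finally show ?thesis by (simp add: measure_pmf.emeasure_eq_measure)
  qed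
  also have "ennreal (chain_prob k y ys) * ennreal (pmf (k x) y) = ennreal (chain_prob k x (y # ys))"
  proof -
    have "0 \<le> chain_prob k y ys" by (simp add: chain_prob_eq prod_nonneg)
    then show ?thesis by (simp add: ennreal_mult mult.commute)
  qed
  finally show ?case .
qed

lemma markov_chain_exists:
  fixes k :: "'s::countable \<Rightarrow> 's pmf" and w :: "'s pmf"
  assumes S: "finite S" and w: "set_pmf w \<subseteq> S" and k: "\<And>x. x \<in> S \<Longrightarrow> set_pmf (k x) \<subseteq> S"
  obtains N where "prob_space N" "sets N = sets (stream_space (count_space UNIV))"
    "\<And>x xs. set (x # xs) \<subseteq> S \<Longrightarrow>
       measure N {s. stake (length (x # xs)) s = x # xs} = pmf w x * chain_prob k x xs"
    "AE s in N. s !! 0 \<in> set_pmf w \<and> (\<forall>n. s !! Suc n \<in> set_pmf (k (s !! n)))"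
proof -
  define R where "R = Pi_pmf S undefined k"
  let ?M = "stream_space (measure_pmf R)"
  let ?C = "stream_space (count_space (UNIV::'s set))"
  interpret R: prob_space ?M
    by (rule prob_space.prob_space_stream_space[OF prob_space_measure_pmf])
  let ?c = "\<lambda>(x, \<omega>). chain x \<omega>"
  have m: "?c \<in> measure_pmf w \<Otimes>\<^sub>M ?M \<rightarrow>\<^sub>M ?C"
    unfolding split_beta
  proof (rule measurable_compose_countable[where g = fst])
    show "(\<lambda>z. chain i (snd z)) \<in> measure_pmf w \<Otimes>\<^sub>M ?M \<rightarrow>\<^sub>M ?C" for i
      by (rule measurable_compose[OF measurable_snd measurable_chain])
    show "fst \<in> measure_pmf w \<Otimes>\<^sub>M ?M \<rightarrow>\<^sub>M count_space UNIV"
      by (rule measurable_compose[OF measurable_fst]) simp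
  qed
  interpret P: pair_prob_space "measure_pmf w" ?M ..
  let ?N = "distr (measure_pmf w \<Otimes>\<^sub>M ?M) ?C ?c"
  have N: "prob_space ?N" by (rule P.prob_space_distr[OF m])
  have "measure ?N {s. stake (length (x # xs)) s = x # xs} = pmf w x * chain_prob k x xs"
    if xs: "set (x # xs) \<subseteq> S" for x xs
  proof -
    let ?A = "{s. stake (length (x # xs)) s = x # xs}"
    have "{s \<in> space ?C. stake (length (x # xs)) s = x # xs} \<in> sets ?C" by measurable
    then have A: "?A \<in> sets ?C" by (simp add: space_stream_space)
    let ?B = "?c -` ?A \<inter> space (measure_pmf w \<Otimes>\<^sub>M ?M)"
    have "emeasure ?N ?A = emeasure (measure_pmf w \<Otimes>\<^sub>M ?M) ?B"
      by (rule emeasure_distr[OF m A])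
    also have "\<dots> = (\<integral>\<^sup>+ y. emeasure ?M (Pair y -` ?B) \<partial>w)"
      by (rule R.emeasure_pair_measure_alt) (rule measurable_sets[OF m A])
    also have "\<dots> = (\<integral>\<^sup>+ y. ennreal (chain_prob k x xs) * indicator {x} y \<partial>w)"
    proof (rule nn_integral_cong)
      fix y
      have "Pair y -` ?B = {\<omega> \<in> space ?M. y = x \<and> stake (length xs) (stl (chain x \<omega>)) = xs}"
        by (auto simp: space_pair_measure)
      then show "emeasure ?M (Pair y -` ?B) = ennreal (chain_prob k x xs) * indicator {x} y"
        using emeasure_chain[OF S, of x xs k] xs by (cases "y = x") (auto simp: R_def)
    qed
    also have "\<dots> = ennreal (chain_prob k x xs) * ennreal (pmf w x)"
      by (simp add: nn_integral_cmult emeasure_pmf_single)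
    finally have e: "emeasure ?N ?A = ennreal (chain_prob k x xs) * ennreal (pmf w x)" .
    have "0 \<le> chain_prob k x xs" by (simp add: chain_prob_eq prod_nonneg)
    with e show ?thesis by (simp add: measure_def enn2real_mult)
  qed
  moreover have "AE s in ?N. s !! 0 \<in> set_pmf w \<and> (\<forall>n. s !! Suc n \<in> set_pmf (k (s !! n)))"
  proof -
    let ?P = "\<lambda>s. s !! 0 \<in> set_pmf w \<and> (\<forall>n. s !! Suc n \<in> set_pmf (k (s !! n)))"
    have P: "{s \<in> space ?C. ?P s} \<in> sets ?C"
    proof -
      have [measurable]: "Measurable.pred ?C (\<lambda>s. s !! Suc n \<in> set_pmf (k (s !! n)))" for n
        by (rule measurable_compose_countable[where f = "\<lambda>i s. s !! Suc n \<in> set_pmf (k i)"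
              and g = "\<lambda>s. s !! n"]) measurable
      show ?thesis by measurable
    qed
    have "AE \<omega> in ?M. ?P (chain x \<omega>)" if x: "x \<in> set_pmf w" for x
    proof -
      have "AE \<omega> in ?M. stream_all (\<lambda>g. g \<in> set_pmf R) \<omega>"
        by (rule prob_space.AE_stream_all[OF prob_space_measure_pmf]) (auto simp: AE_measure_pmf)
      then show ?thesis
      proof (rule AE_mp, intro AE_I2 impI)
        fix \<omega> assume "stream_all (\<lambda>g. g \<in> set_pmf R) \<omega>"
        then have g: "(\<omega> !! n) y \<in> set_pmf (k y)" if "y \<in> S" for n y
          using that set_Pi_pmf[OF S, of undefined k]
          by (auto simp: R_def stream_all_def PiE_dflt_def)
        have "chain x \<omega> !! n \<in> S" for n
        proof (induction n)
          case 0 then show ?case using x w by auto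
        next
          case (Suc n) then show ?case using g[OF Suc] k[OF Suc] unfolding chain_snth_Suc by blast
        qed
        then show "?P (chain x \<omega>)" using g x unfolding chain_snth_Suc by simp
      qed
    qed
    then have "AE x in measure_pmf w. AE \<omega> in ?M. ?P (?c (x, \<omega>))"
      by (simp add: AE_measure_pmf_iff)
    then have "AE z in measure_pmf w \<Otimes>\<^sub>M ?M. ?P (?c z)"
    proof (rule P.AE_pair_measure[rotated])
      have "?c -` {s \<in> space ?C. ?P s} \<inter> space (measure_pmf w \<Otimes>\<^sub>M ?M) \<in> sets (measure_pmf w \<Otimes>\<^sub>M ?M)"
        by (rule measurable_sets[OF m P])
      also have "?c -` {s \<in> space ?C. ?P s} \<inter> space (measure_pmf w \<Otimes>\<^sub>M ?M)
          = {z \<in> space (measure_pmf w \<Otimes>\<^sub>M ?M). ?P (?c z)}"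
        by (auto simp: space_stream_space)
      finally show "{z \<in> space (measure_pmf w \<Otimes>\<^sub>M ?M). ?P (?c z)} \<in> sets (measure_pmf w \<Otimes>\<^sub>M ?M)" .
    qed
    then show ?thesis by (subst AE_distr_iff[OF m P])
  qed
  ultimately show ?thesis using N by (intro that[of ?N]) auto
qed

lemma path_space_sets:
  fixes \<theta> :: "'a::finite \<Rightarrow> 'a list"
  shows "path_space \<theta> \<in> sets (stream_space (count_space UNIV))"
proof -
  let ?C = "stream_space (count_space (UNIV :: ('a \<times> nat) set))"
  have "{x \<in> space ?C. (\<forall>i. x !! i \<in> states \<theta>) \<and>
      (\<forall>i. fst (x !! i) = \<theta> (fst (x !! Suc i)) ! (snd (x !! Suc i) - 1))} \<in> sets ?C"
    by measurable
  also have "{x \<in> space ?C. (\<forall>i. x !! i \<in> states \<theta>) \<and>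
      (\<forall>i. fst (x !! i) = \<theta> (fst (x !! Suc i)) ! (snd (x !! Suc i) - 1))} = path_space \<theta>"
    by (auto simp: path_space_def space_stream_space streams_iff_snth)
  finally show ?thesis .
qed

lemma finite_states: "finite (states (\<theta> :: 'a::finite \<Rightarrow> 'a list))"
proof (rule finite_subset)
  show "states \<theta> \<subseteq> (SIGMA a:UNIV. {..length (\<theta> a)})" by (auto simp: states_def)
qed auto

lemma pf_facts:
  fixes \<theta> :: "'a::finite \<Rightarrow> 'a list"
  assumes prim: "primitive_subst \<theta>" and rho: "pf_right_eigenvector \<theta> \<rho>"
  shows "0 < pf_eigenvalue \<theta>" "states \<theta> \<noteq> {}"
proof -
  let ?M = "subst_matrix \<theta> :: real ^ 'a ^ 'a"
  fix a :: 'a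
  obtain k where k: "0 < k" "\<And>a b. 0 < ((((**) ?M) ^^ k) (mat 1)) $ a $ b"
    using prim by (auto simp: primitive_subst_def)
  then obtain l where "k = Suc l" by (cases k) auto
  then have "0 < (\<Sum>b\<in>UNIV. ?M $ a $ b * ((((**) ?M) ^^ l) (mat 1)) $ b $ a)"
    using k(2)[of a a] by (simp add: matrix_matrix_mult_def)
  then have "(\<Sum>b\<in>UNIV. ?M $ a $ b * ((((**) ?M) ^^ l) (mat 1)) $ b $ a) \<noteq> 0"
    by (rule less_imp_neq[symmetric])
  then have "\<exists>b. ?M $ a $ b * ((((**) ?M) ^^ l) (mat 1)) $ b $ a \<noteq> 0"
    by (rule sum.not_neutral_contains_not_neutral) blast
  then obtain b where b: "?M $ a $ b \<noteq> 0" by auto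
  then have "\<theta> b \<noteq> []" by (auto simp: subst_matrix_def)
  then have "(b, 1) \<in> states \<theta>" by (cases "\<theta> b") (auto simp: states_def)
  then show "states \<theta> \<noteq> {}" by auto
  have M0: "0 \<le> ?M $ a $ b" for a b by (simp add: subst_matrix_def)
  have r: "0 < \<rho> a" for a using rho by (auto simp: pf_right_eigenvector_def)
  have "0 < ?M $ a $ b" using b M0[of a b] by linarith
  then have "0 < ?M $ a $ b * \<rho> b" using r[of b] by (rule mult_pos_pos)
  also have "\<dots> \<le> (\<Sum>b\<in>UNIV. ?M $ a $ b * \<rho> b)"
    by (rule member_le_sum) (simp_all add: M0 less_imp_le[OF r])
  also have "\<dots> = pf_eigenvalue \<theta> * \<rho> a"
    using rho by (auto simp: pf_right_eigenvector_def)
  finally show "0 < pf_eigenvalue \<theta>" using r[of a] by (simp add: zero_less_mult_iff)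
qed

lemma trans_prob_sum:
  fixes \<theta> :: "'a::finite \<Rightarrow> 'a list"
  assumes prim: "primitive_subst \<theta>" and rho: "pf_right_eigenvector \<theta> \<rho>"
  shows "(\<Sum>z\<in>states \<theta>. trans_prob \<theta> \<rho> x z) = 1"
proof -
  have r: "0 < \<rho> a" for a using rho by (auto simp: pf_right_eigenvector_def)
  have cnt: "(\<Sum>k\<in>{1..length w}. if a = w ! (k - 1) then 1 else 0) = (real (count_list w a))"
    for w :: "'a list" and a
  proof -
    have "(\<Sum>k\<in>{1..length w}. if a = w ! (k - 1) then 1 else 0)
        = (\<Sum>k<length w. if a = w ! k then 1 else (0::real))"
      by (rule sum.reindex_bij_witness[of _ Suc "\<lambda>k. k - 1"]) auto
    also have "\<dots> = real (card {k. k < length w \<and> a = w ! k})"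
      by (simp add: sum.If_cases) (rule arg_cong[of _ _ card], auto)
    finally show ?thesis
      by (simp add: count_list_eq_length_filter length_filter_conv_card)
  qed
  have "(\<Sum>z\<in>states \<theta>. edge \<theta> x z * \<rho> (fst z))
      = (\<Sum>b\<in>UNIV. \<Sum>k\<in>{1..length (\<theta> b)}. edge \<theta> x (b, k) * \<rho> b)"
  proof -
    have "states \<theta> = (SIGMA b:UNIV. {1..length (\<theta> b)})" by (auto simp: states_def)
    then show ?thesis by (simp add: sum.Sigma split_beta)
  qed
  also have "\<dots> = (\<Sum>b\<in>UNIV. subst_matrix \<theta> $ fst x $ b * \<rho> b)"
    using cnt by (simp add: edge_def subst_matrix_def flip: sum_distrib_right)
  also have "\<dots> = pf_eigenvalue \<theta> * \<rho> (fst x)"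
    using rho by (auto simp: pf_right_eigenvector_def)
  finally have e: "(\<Sum>z\<in>states \<theta>. edge \<theta> x z * \<rho> (fst z)) = pf_eigenvalue \<theta> * \<rho> (fst x)" .
  have "(\<Sum>z\<in>states \<theta>. trans_prob \<theta> \<rho> x z)
      = (\<Sum>z\<in>states \<theta>. edge \<theta> x z * \<rho> (fst z)) / (pf_eigenvalue \<theta> * \<rho> (fst x))"
    by (simp add: trans_prob_def sum_divide_distrib)
  also have "\<dots> = 1"
    using pf_facts(1)[OF assms] r[of "fst x"] unfolding e by simp
  finally show ?thesis .
qed

lemma embed_pmf_on:
  assumes "finite S" "\<And>x. x \<in> S \<Longrightarrow> 0 \<le> g x" "sum g S = 1"
  shows "pmf (embed_pmf (\<lambda>x. if x \<in> S then g x else 0)) x = (if x \<in> S then g x else 0)"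
proof (rule pmf_embed_pmf)
  show "(\<integral>\<^sup>+ x. ennreal (if x \<in> S then g x else 0) \<partial>count_space UNIV) = 1"
    using assms by (subst nn_integral_count_space'[of S]) (auto simp: sum_ennreal)
qed (use assms in auto)

lemma markov_law_unique:
  fixes E :: "'s stream set"
  assumes S: "countable S" and E: "E \<in> sets (stream_space (count_space UNIV))" "E \<subseteq> streams S"
    and M1: "markov_law E S w p M1" and M2: "markov_law E S w p M2"
  shows "M1 = M2"
proof -
  let ?C = "stream_space (count_space (UNIV :: 's set))"
  let ?D = "\<lambda>M. distr M ?C (\<lambda>x. x)"
  have law: "prob_space M" "space M = E" "sets M = sets (restrict_space ?C E)"
    "\<And>xs. xs \<noteq> [] \<Longrightarrow> set xs \<subseteq> S \<Longrightarrow> measure M {x \<in> E. stake (length xs) x = xs} =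
        w (hd xs) * (\<Prod>i<length xs - 1. p (xs ! i) (xs ! Suc i))"
    if "markov_law E S w p M" for M
    using that unfolding markov_law_def by blast+
  have id: "(\<lambda>x. x) \<in> M \<rightarrow>\<^sub>M ?C" if M: "markov_law E S w p M" for M
    unfolding measurable_cong_sets[OF law(3)[OF M] refl] by (rule measurable_restrict_space1) simp
  have D: "prob_space (?D M)" "AE x in ?D M. x \<in> streams S"
    "\<And>xs. xs \<noteq> [] \<Longrightarrow> xs \<in> lists S \<Longrightarrow> emeasure (?D M) (sstart S xs) =
       ennreal (w (hd xs) * (\<Prod>i<length xs - 1. p (xs ! i) (xs ! Suc i)))"
    if M: "markov_law E S w p M" for M
  proof -
    interpret M: prob_space M by (rule law(1)[OF M])
    note sp = law(2)[OF M]
    show "prob_space (?D M)" by (rule M.prob_space_distr[OF id[OF M]])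
    have "{x \<in> space ?C. x \<in> streams S} \<in> sets ?C"
      using streams_sets[of S "count_space UNIV"] by (simp add: space_stream_space)
    then show "AE x in ?D M. x \<in> streams S"
    proof (subst AE_distr_iff[OF id[OF M]])
      show "AE x in M. x \<in> streams S" by (rule AE_I2) (use E(2) sp in blast)
    qed assumption
    fix xs assume xs: "xs \<noteq> []" "xs \<in> lists S"
    have "emeasure (?D M) (sstart S xs) = emeasure M (sstart S xs \<inter> E)"
      by (subst emeasure_distr[OF id[OF M]]) (auto simp: sp vimage_def Int_def)
    also have "sstart S xs \<inter> E = {s \<in> E. stake (length xs) s = xs}"
    proof -
      have "x \<in> sstart S xs \<longleftrightarrow> stake (length xs) x = xs" if "x \<in> E" for x
        using that E(2) by (subst sstart_eq) (auto simp: list_eq_iff_nth_eq)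
      then show ?thesis by blast
    qed
    also have "emeasure M \<dots> = ennreal (w (hd xs) * (\<Prod>i<length xs - 1. p (xs ! i) (xs ! Suc i)))"
    proof -
      have "set xs \<subseteq> S" using xs by (simp add: lists_eq_set)
      with law(4)[OF M xs(1)] show ?thesis by (simp add: M.emeasure_eq_measure)
    qed
    finally show "emeasure (?D M) (sstart S xs) =
        ennreal (w (hd xs) * (\<Prod>i<length xs - 1. p (xs ! i) (xs ! Suc i)))" .
  qed
  have eq: "?D M1 = ?D M2"
  proof (rule stream_space_eq_sstart[OF S D(1)[OF M1] D(1)[OF M2] D(2)[OF M1] D(2)[OF M2]])
    fix xs assume xs: "xs \<noteq> []" "xs \<in> lists S"
    show "emeasure (?D M1) (sstart S xs) = emeasure (?D M2) (sstart S xs)"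
      by (rule trans[OF D(3)[OF M1 xs] D(3)[OF M2 xs, symmetric]])
  qed (simp_all only: sets_distr)
  show ?thesis
  proof (rule measure_eqI)
    show "sets M1 = sets M2" by (simp only: law(3)[OF M1] law(3)[OF M2])
    fix A assume "A \<in> sets M1"
    then have "A \<in> sets (restrict_space ?C E)" by (simp only: law(3)[OF M1])
    then have A: "A \<in> sets ?C" "A \<subseteq> E"
      using sets_restrict_space_iff[of E ?C A] E(1) by (auto simp: space_stream_space)
    have "emeasure (?D M) A = emeasure M A" if M: "markov_law E S w p M" for M
    proof -
      have "emeasure (?D M) A = emeasure M ((\<lambda>x. x) -` A \<inter> space M)"
        by (rule emeasure_distr[OF id[OF M] A(1)])
      also have "(\<lambda>x. x) -` A \<inter> space M = A" using A(2) law(2)[OF M] by auto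
      finally show ?thesis .
    qed
    with eq M1 M2 show "emeasure M1 A = emeasure M2 A" by metis
  qed
qed

theorem MPM_ex1:
  fixes \<theta> :: "'a::finite \<Rightarrow> 'a list"
  assumes prim: "primitive_subst \<theta>" and rho: "pf_right_eigenvector \<theta> \<rho>"
  shows "\<exists>!N. markov_law (path_space \<theta>) (states \<theta>) (init_prob \<theta> \<rho>) (trans_prob \<theta> \<rho>) N"
proof -
  let ?S = "states \<theta>" and ?E = "path_space \<theta>"
  let ?C = "stream_space (count_space (UNIV :: ('a \<times> nat) set))"
  note S = finite_states[of \<theta>] and E = path_space_sets[of \<theta>]
  have r: "0 < \<rho> a" for a using rho by (auto simp: pf_right_eigenvector_def)
  note l = pf_facts(1)[OF assms]
  have Estr: "x \<in> streams ?S" if "x \<in> ?E" for x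
    using that unfolding path_space_def by blast
  have s: "0 < (\<Sum>y\<in>?S. \<rho> (fst y))"
    using r S pf_facts(2)[OF assms] by (intro sum_pos) auto
  define w where "w = embed_pmf (\<lambda>x. if x \<in> ?S then init_prob \<theta> \<rho> x else 0)"
  define k where "k x = embed_pmf (\<lambda>z. if z \<in> ?S then trans_prob \<theta> \<rho> x z else 0)" for x
  have w: "pmf w x = (if x \<in> ?S then init_prob \<theta> \<rho> x else 0)" for x
    unfolding w_def
  proof (rule embed_pmf_on[OF S])
    show "0 \<le> init_prob \<theta> \<rho> x" for x
      using less_imp_le[OF r] less_imp_le[OF s] by (simp add: init_prob_def)
    show "sum (init_prob \<theta> \<rho>) ?S = 1"
      using s by (simp add: init_prob_def sum_divide_distrib[symmetric])
  qed
  have k: "pmf (k x) z = (if z \<in> ?S then trans_prob \<theta> \<rho> x z else 0)" for x z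
    unfolding k_def
  proof (rule embed_pmf_on[OF S _ trans_prob_sum[OF assms]])
    show "0 \<le> trans_prob \<theta> \<rho> x z" for z
      using less_imp_le[OF r] l by (simp add: trans_prob_def edge_def)
  qed
  have wS: "set_pmf w \<subseteq> ?S" by (metis set_pmf_iff subsetI w)
  have kS: "set_pmf (k x) \<subseteq> ?S" for x by (metis set_pmf_iff subsetI k)
  obtain N where N: "prob_space N" "sets N = sets ?C"
    and cyl: "\<And>x xs. set (x # xs) \<subseteq> ?S \<Longrightarrow>
       measure N {s. stake (length (x # xs)) s = x # xs} = pmf w x * chain_prob k x xs"
    and ae: "AE s in N. s !! 0 \<in> set_pmf w \<and> (\<forall>n. s !! Suc n \<in> set_pmf (k (s !! n)))"
    by (rule markov_chain_exists[OF S wS kS]) (rule that; assumption)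
  interpret N: prob_space N by (rule N(1))
  have spN: "space N = UNIV" using sets_eq_imp_space_eq[OF N(2)] by (simp add: space_stream_space)
  have aeE: "AE s in N. s \<in> ?E"
    using ae
  proof (rule AE_mp, intro AE_I2 impI)
    fix s assume *: "s !! 0 \<in> set_pmf w \<and> (\<forall>n. s !! Suc n \<in> set_pmf (k (s !! n)))"
    have "s !! n \<in> ?S" for n
    proof (cases n)
      case 0 then show ?thesis using * wS by auto
    next
      case (Suc m)
      from * have "s !! Suc m \<in> set_pmf (k (s !! m))" by blast
      with kS[of "s !! m"] show ?thesis unfolding Suc by blast
    qed
    moreover have "fst (s !! n) = \<theta> (fst (s !! Suc n)) ! (snd (s !! Suc n) - 1)" for n
    proof -
      have "s !! Suc n \<in> set_pmf (k (s !! n))" using * by blast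
      then have "trans_prob \<theta> \<rho> (s !! n) (s !! Suc n) \<noteq> 0"
        by (simp add: set_pmf_iff k del: snth.simps split: if_splits)
      then have "edge \<theta> (s !! n) (s !! Suc n) \<noteq> 0" by (auto simp: trans_prob_def)
      then show ?thesis unfolding edge_def by presburger
    qed
    ultimately show "s \<in> ?E"
      unfolding path_space_def streams_iff_snth by blast
  qed
  have EN: "?E \<inter> space N \<in> sets N" using E N(2) by (simp add: spN)
  let ?R = "restrict_space N ?E"
  have law: "markov_law ?E ?S (init_prob \<theta> \<rho>) (trans_prob \<theta> \<rho>) ?R"
    unfolding markov_law_def
  proof (intro conjI allI impI)
    show sp: "space ?R = ?E" by (simp add: space_restrict_space spN)
    show "sets ?R = sets (restrict_space ?C ?E)" by (intro sets_restrict_space_cong N(2))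
    show "prob_space ?R"
    proof (rule prob_spaceI)
      have "emeasure ?R (space ?R) = emeasure N ?E"
        unfolding sp by (rule emeasure_restrict_space[OF EN]) simp
      also have "\<dots> = 1" by (rule N.emeasure_eq_1_AE) (simp_all only: N(2) E aeE)
      finally show "emeasure ?R (space ?R) = 1" .
    qed
    fix xs assume xs: "xs \<noteq> [] \<and> set xs \<subseteq> ?S"
    then obtain y ys where y: "xs = y # ys" by (cases xs) auto
    have "{s \<in> space ?C. stake (length xs) s = xs} \<in> sets ?C" by measurable
    then have A: "{s. stake (length xs) s = xs} \<in> sets N" by (simp add: N(2) space_stream_space)
    have "measure ?R {s \<in> ?E. stake (length xs) s = xs} = measure N {s \<in> ?E. stake (length xs) s = xs}"
      by (rule measure_restrict_space[OF EN]) blast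
    also have "\<dots> = measure N {s. stake (length xs) s = xs}"
    proof (rule N.finite_measure_eq_AE)
      show "AE x in N. (x \<in> {s \<in> ?E. stake (length xs) s = xs}) = (x \<in> {s. stake (length xs) s = xs})"
        using aeE by (rule AE_mp) (intro AE_I2 impI, blast)
      have "{s \<in> ?E. stake (length xs) s = xs} = ?E \<inter> {s. stake (length xs) s = xs}" by blast
      then show "{s \<in> ?E. stake (length xs) s = xs} \<in> sets N"
        using sets.Int[OF _ A, of ?E] E N(2) by (simp only:)
    qed (rule A)
    also have "\<dots> = pmf w y * chain_prob k y ys" unfolding y by (rule cyl) (use xs y in blast)
    also have "\<dots> = init_prob \<theta> \<rho> (hd xs) *
        (\<Prod>i<length xs - 1. trans_prob \<theta> \<rho> (xs ! i) (xs ! Suc i))"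
    proof -
      have "chain_prob k y ys = (\<Prod>i<length ys. trans_prob \<theta> \<rho> ((y # ys) ! i) (ys ! i))"
        unfolding chain_prob_eq
      proof (intro prod.cong refl)
        fix i assume "i \<in> {..<length ys}"
        then have "ys ! i \<in> set xs" by (simp add: y)
        then have "ys ! i \<in> ?S" using xs by blast
        then show "pmf (k ((y # ys) ! i)) (ys ! i) = trans_prob \<theta> \<rho> ((y # ys) ! i) (ys ! i)"
          unfolding k by (rule if_P)
      qed
      moreover have "y \<in> ?S" using xs y by auto
      ultimately show ?thesis unfolding y by (simp add: w)
    qed
    finally show "measure ?R {s \<in> ?E. stake (length xs) s = xs} = init_prob \<theta> \<rho> (hd xs) *
        (\<Prod>i<length xs - 1. trans_prob \<theta> \<rho> (xs ! i) (xs ! Suc i))" .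
  qed
  have Es: "path_space \<theta> \<subseteq> streams ?S" using Estr by blast
  show ?thesis
  proof (rule ex1I)
    show "markov_law ?E ?S (init_prob \<theta> \<rho>) (trans_prob \<theta> \<rho>) ?R" by (rule law)
    fix M assume "markov_law ?E ?S (init_prob \<theta> \<rho>) (trans_prob \<theta> \<rho>) M"
    then show "M = ?R" using law by (rule markov_law_unique[OF countable_finite[OF S] E Es])
  qed
qed

corollary markov_law_MPM:
  assumes "primitive_subst \<theta>" "pf_right_eigenvector \<theta> \<rho>"
  shows "markov_law (path_space \<theta>) (states \<theta>) (init_prob \<theta> \<rho>) (trans_prob \<theta> \<rho>) (MPM \<theta> \<rho>)"
  unfolding MPM_def by (rule theI'[OF MPM_ex1[OF assms]])

end

theory Submission
  imports Defs
begin

text \<open>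
  Write \<open>|w|\<close> for the length of a word and \<open>S\<close> for summation of \<open>f\<close> over its letters. The eigenfunction
  equation says \<open>S(\<theta>\<^sup>m(w)) = \<mu>\<^sup>m S(w)\<close>. A fixed point \<open>u\<close> is, for every \<open>m\<close>, the image under \<open>\<theta>\<^sup>m\<close> of another
  fixed point \<open>v\<close>, so a prefix of \<open>u\<close> consists of the blocks \<open>\<theta>\<^sup>m(v\<^sub>i)\<close> of a prefix of \<open>v\<close> and a prefix of one
  further block. The prefix sums of all fixed points are bounded because \<open>\<bar>\<mu>\<bar> < 1\<close>, hence the complete
  blocks contribute \<open>O(\<bar>\<mu>\<bar>\<^sup>m)\<close>: up to this error the prefix sum depends only on the letter \<open>b\<close> of the last
  block and on the position inside \<open>\<theta>\<^sup>m(b)\<close> (\<open>prefix_sum_split\<close>, \<open>prefix_sum_bounded\<close>).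

  On the other side, the first \<open>m\<close> states of a path address a position inside a word \<open>\<theta>\<^sup>m(b)\<close>, the
  corresponding partial sum of \<open>W\<close> is the sum of \<open>f\<close> over the letters before this position
  (\<open>sum_over_paths\<close>), and the Markov measure gives each such address the probability
  \<open>\<rho>(b) / (\<Lambda>\<^sup>m R)\<close>, where \<open>\<Lambda>\<close> is the Perron-Frobenius eigenvalue and \<open>R\<close> is the sum of the values of \<open>\<rho>\<close>
  (\<open>path_prob\<close>). So the limit law arises from choosing a uniformly distributed position in blocks
  whose letters occur with frequencies proportional to \<open>\<rho>\<close>.

  It remains to see that the letters of a fixed point have these frequencies. Equivalently, a weight \<open>D\<close>
  on letters with \<open>\<Sum>a. \<rho>(a) D(a) = 0\<close> has sublinear sums over prefixes (\<open>zero_mean_prefix_sums\<close>). If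
  all entries of the \<open>e\<close>-th power of the matrix are positive, then that power contracts such weights in
  the norm \<open>\<Sum>a. \<rho>(a) \<bar>D(a)\<bar>\<close> by the factor \<open>\<Lambda>\<^sup>e - 1\<close>, strictly less than the growth factor \<open>\<Lambda>\<^sup>e\<close> of the
  lengths (\<open>contraction\<close>, \<open>zero_mean_image_small\<close>). The three ingredients are combined in
  \<open>average_deviation\<close>.
\<close>


section \<open>Sums over the letters of a word\<close>

abbreviation letter_sum :: "('a \<Rightarrow> 'c::comm_monoid_add) \<Rightarrow> 'a list \<Rightarrow> 'c" where
  "letter_sum g w \<equiv> sum_list (map g w)"

abbreviation subst_word :: "('a \<Rightarrow> 'b list) \<Rightarrow> 'a list \<Rightarrow> 'b list" where
  "subst_word \<sigma> w \<equiv> concat (map \<sigma> w)"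

lemma letter_sum_subst_word:
  "letter_sum g (subst_word \<sigma> w) = letter_sum (\<lambda>a. letter_sum g (\<sigma> a)) w"
  by (induction w) auto

lemma length_eq_letter_sum: "real (length w) = letter_sum (\<lambda>_. 1) w"
  by (induction w) auto

lemma count_list_eq_letter_sum: "real (count_list w a) = letter_sum (\<lambda>b. if b = a then 1 else 0) w"
  by (induction w) auto

lemma letter_sum_eq_sum_count:
  fixes w :: "'a::finite list" and g :: "'a \<Rightarrow> 'c::comm_semiring_1"
  shows "letter_sum g w = (\<Sum>a\<in>UNIV. of_nat (count_list w a) * g a)"
proof (induction w)
  case (Cons b w)
  have "of_nat (count_list (b # w) a) * g a
      = (if b = a then g a else 0) + of_nat (count_list w a) * g a" for a
    by (simp add: algebra_simps)
  then show ?case using Cons by (simp add: sum.distrib)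
qed simp

lemma letter_sum_mult_left:
  fixes g :: "'a \<Rightarrow> 'c::comm_semiring_1"
  shows "letter_sum (\<lambda>a. c * g a) w = c * letter_sum g w"
  by (induction w) (auto simp: algebra_simps)

lemma sum_over_word:
  fixes g :: "'a \<Rightarrow> 'c::comm_monoid_add"
  shows "(\<Sum>r<length w. g (w ! r)) = letter_sum g w"
  by (simp add: sum_list_sum_nth atLeast0LessThan)

text \<open>
  Cutting a substituted word anywhere leaves complete blocks and a prefix of one further block. When
  the word ends before position \<open>n\<close>, the further block is arbitrary and its prefix is empty.
\<close>

lemma take_subst_word:
  "\<exists>j r c. take n (subst_word \<sigma> w) = subst_word \<sigma> (take j w) @ take r (\<sigma> c)"
proof (induction w arbitrary: n)
  case Nil
  show ?case by (rule exI[of _ 0], rule exI[of _ 0]) simp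
next
  case (Cons a w)
  show ?case
  proof (cases "n \<le> length (\<sigma> a)")
    case True
    then show ?thesis by (intro exI[of _ 0] exI[of _ n] exI[of _ a]) simp
  next
    case False
    obtain j r c where "take (n - length (\<sigma> a)) (subst_word \<sigma> w)
        = subst_word \<sigma> (take j w) @ take r (\<sigma> c)"
      using Cons by blast
    with False show ?thesis by (intro exI[of _ "Suc j"] exI[of _ r] exI[of _ c]) simp
  qed
qed

lemma sum_lessThan_add:
  fixes g :: "nat \<Rightarrow> 'c::comm_monoid_add"
  shows "(\<Sum>n<a + b. g n) = (\<Sum>n<a. g n) + (\<Sum>r<b. g (a + r))"
  by (induction b) (auto simp: add.assoc)

text \<open>
  Here the decomposition into complete blocks and a proper prefix of the next block is unique, so that
  it reindexes a sum over all proper prefixes. It is what makes the recursion for the values of \<open>W\<close>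
  along finite paths agree with the recursion \<open>\<theta>\<^sup>m\<^sup>+\<^sup>1(c) = \<theta>\<^sup>m(\<theta>(c))\<close>.
\<close>

lemma sum_prefixes_subst_word:
  fixes h :: "'b list \<Rightarrow> 'c::comm_monoid_add"
  shows "(\<Sum>n<length (subst_word \<sigma> w). h (take n (subst_word \<sigma> w))) =
    (\<Sum>k<length w. \<Sum>r<length (\<sigma> (w ! k)). h (subst_word \<sigma> (take k w) @ take r (\<sigma> (w ! k))))"
proof (induction w arbitrary: h)
  case (Cons a w)
  show ?case
    using Cons[of "\<lambda>z. h (\<sigma> a @ z)"]
    by (simp add: sum_lessThan_add sum.lessThan_Suc_shift del: sum.lessThan_Suc)
qed simp


section \<open>Iterated substitutions\<close>

text \<open>
  The word \<open>\<theta>\<^sup>m(a)\<close>. The recursion applies the iterate to the image of the letter; the opposite order is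
  \<open>subst_iter_Suc_outer\<close> below, and both are needed.
\<close>

primrec subst_iter :: "('a \<Rightarrow> 'a list) \<Rightarrow> nat \<Rightarrow> 'a \<Rightarrow> 'a list" where
  "subst_iter \<theta> 0 a = [a]"
| "subst_iter \<theta> (Suc m) a = subst_word (subst_iter \<theta> m) (\<theta> a)"

lemma subst_word_subst_word:
  "subst_word \<sigma> (subst_word \<tau> w) = subst_word (\<lambda>a. subst_word \<sigma> (\<tau> a)) w"
  by (induction w) auto

lemma subst_iter_add: "subst_iter \<theta> (m + n) a = subst_word (subst_iter \<theta> m) (subst_iter \<theta> n a)"
proof (induction n arbitrary: a)
  case (Suc n)
  then show ?case by (simp add: subst_word_subst_word cong: map_cong)
qed simp

lemma subst_iter_Suc_outer: "subst_iter \<theta> (Suc m) a = subst_word \<theta> (subst_iter \<theta> m a)"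
proof -
  have "subst_word (subst_iter \<theta> 0) w = w" for w by (induction w) auto
  then have "subst_iter \<theta> 1 = \<theta>" by (simp add: fun_eq_iff)
  then show ?thesis using subst_iter_add[of \<theta> 1 m a] by simp
qed

lemma matrix_power_entry:
  fixes \<theta> :: "'a::finite \<Rightarrow> 'a list"
  shows "((((**) (subst_matrix \<theta> :: real ^ 'a ^ 'a)) ^^ k) (mat 1)) $ a $ b
    = real (count_list (subst_iter \<theta> k b) a)"
proof (induction k arbitrary: a)
  case 0
  show ?case by (simp add: mat_def)
next
  case (Suc k)
  have "real (count_list (subst_iter \<theta> (Suc k) b) a)
      = letter_sum (\<lambda>c. real (count_list (\<theta> c) a)) (subst_iter \<theta> k b)"
    unfolding subst_iter_Suc_outer count_list_eq_letter_sum letter_sum_subst_word ..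
  also have "\<dots> = (\<Sum>c\<in>UNIV. real (count_list (subst_iter \<theta> k b) c) * real (count_list (\<theta> c) a))"
    by (simp add: letter_sum_eq_sum_count)
  finally show ?case
    using Suc by (simp add: matrix_matrix_mult_def subst_matrix_def mult.commute)
qed

locale primitive_substitution =
  fixes \<theta> :: "'a::finite \<Rightarrow> 'a list" and \<rho> :: "'a \<Rightarrow> real"
  assumes prim: "primitive_subst \<theta>" and eigvec: "pf_right_eigenvector \<theta> \<rho>"
begin

subsection \<open>Zero-mean weights cancel on long blocks\<close>

abbreviation "\<Lambda> \<equiv> pf_eigenvalue \<theta>"

abbreviation "R \<equiv> (\<Sum>a\<in>UNIV. \<rho> a)"

lemma \<rho>_pos: "0 < \<rho> a"
  using eigvec by (simp add: pf_right_eigenvector_def)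

lemma R_pos: "0 < R"
  by (rule sum_pos) (auto simp: \<rho>_pos)

lemma \<rho>_le_R: "\<rho> a \<le> R"
  by (rule member_le_sum) (auto simp: less_imp_le[OF \<rho>_pos])

lemma \<Lambda>_pos: "0 < \<Lambda>"
  by (rule pf_facts(1)[OF prim eigvec])

lemma positive_power:
  obtains e where "0 < e" "\<And>a b. 1 \<le> count_list (subst_iter \<theta> e b) a"
proof -
  obtain e where "0 < e" "\<forall>a b. 0 < real (count_list (subst_iter \<theta> e b) a)"
    using prim unfolding primitive_subst_def matrix_power_entry by blast
  then show ?thesis by (intro that[of e]) (auto simp: Suc_le_eq)
qed

lemma nonempty: "\<theta> b \<noteq> []"
proof
  assume b: "\<theta> b = []"
  obtain e where e: "0 < e" "\<And>a b. 1 \<le> count_list (subst_iter \<theta> e b) a"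
    by (rule positive_power) blast
  from e(1) obtain k where "e = Suc k" by (cases e) auto
  with e(2)[of b b] b show False by simp
qed

lemma iter_nonempty: "subst_iter \<theta> m b \<noteq> []"
proof (induction m arbitrary: b)
  case (Suc m)
  then show ?case using nonempty[of b] by (cases "\<theta> b") auto
qed simp

text \<open>
  Summing a weight \<open>D\<close> over \<open>\<theta>\<^sup>m(b)\<close> is the action of the row vector \<open>D\<close> on the \<open>m\<close>-th power of the matrix,
  so pairing with the right eigenvector \<open>\<rho>\<close> only produces the factor \<open>\<Lambda>\<^sup>m\<close>. In particular the mean with
  respect to \<open>\<rho>\<close> being zero is preserved.
\<close>

lemma eigenvector_duality:
  "(\<Sum>b\<in>UNIV. \<rho> b * letter_sum D (subst_iter \<theta> m b)) = \<Lambda> ^ m * (\<Sum>a\<in>UNIV. \<rho> a * D a)"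
proof (induction m arbitrary: D)
  case (Suc m)
  have "(\<Sum>b\<in>UNIV. \<rho> b * letter_sum D (subst_iter \<theta> (Suc m) b))
      = \<Lambda> ^ m * (\<Sum>b\<in>UNIV. \<rho> b * letter_sum D (\<theta> b))"
    unfolding subst_iter_Suc_outer letter_sum_subst_word by (rule Suc)
  also have "(\<Sum>b\<in>UNIV. \<rho> b * letter_sum D (\<theta> b))
      = (\<Sum>b\<in>UNIV. \<Sum>a\<in>UNIV. D a * (subst_matrix \<theta> $ a $ b * \<rho> b))"
    by (simp add: letter_sum_eq_sum_count subst_matrix_def sum_distrib_left mult_ac)
  also have "\<dots> = (\<Sum>a\<in>UNIV. D a * (\<Sum>b\<in>UNIV. subst_matrix \<theta> $ a $ b * \<rho> b))"
    by (subst sum.swap) (simp add: sum_distrib_left)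
  also have "\<dots> = \<Lambda> * (\<Sum>a\<in>UNIV. \<rho> a * D a)"
    using eigvec by (simp add: pf_right_eigenvector_def sum_distrib_left mult_ac)
  finally show ?case by simp
qed simp

text \<open>
  A Doeblin-type estimate. The entries of the \<open>e\<close>-th power of the matrix are integers, so positivity makes
  them at least \<open>1\<close>, hence at least \<open>\<rho> a / R\<close>. For a weight of mean zero the amount \<open>\<rho> a / R\<close> can be
  subtracted from the entry in row \<open>a\<close> without changing the sum; taking absolute values afterwards
  saves exactly \<open>1\<close> from the trivial factor \<open>\<Lambda>\<^sup>e\<close>.
\<close>

lemma contraction:
  assumes pos: "\<And>a b. 1 \<le> count_list (subst_iter \<theta> e b) a"
    and zero: "(\<Sum>a\<in>UNIV. \<rho> a * D a) = 0"
  shows "(\<Sum>b\<in>UNIV. \<rho> b * \<bar>letter_sum D (subst_iter \<theta> e b)\<bar>)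
    \<le> (\<Lambda> ^ e - 1) * (\<Sum>a\<in>UNIV. \<rho> a * \<bar>D a\<bar>)"
proof -
  let ?N = "\<Sum>a\<in>UNIV. \<rho> a * \<bar>D a\<bar>"
  have "\<bar>letter_sum D (subst_iter \<theta> e b)\<bar> \<le> letter_sum (\<lambda>a. \<bar>D a\<bar>) (subst_iter \<theta> e b) - ?N / R" for b
  proof -
    let ?m = "\<lambda>a. real (count_list (subst_iter \<theta> e b) a)"
    have split: "(\<Sum>a\<in>UNIV. (?m a - \<rho> a / R) * g a)
        = letter_sum g (subst_iter \<theta> e b) - (\<Sum>a\<in>UNIV. \<rho> a * g a) / R" for g :: "'a \<Rightarrow> real"
      by (simp add: letter_sum_eq_sum_count left_diff_distrib sum_subtractf sum_divide_distrib)
    have nonneg: "0 \<le> ?m a - \<rho> a / R" for a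
    proof -
      have "\<rho> a / R \<le> 1" using \<rho>_le_R[of a] R_pos by simp
      moreover have "1 \<le> ?m a" using pos[of b a] by simp
      ultimately show ?thesis by linarith
    qed
    have "\<bar>letter_sum D (subst_iter \<theta> e b)\<bar> = \<bar>\<Sum>a\<in>UNIV. (?m a - \<rho> a / R) * D a\<bar>"
      using split[of D] zero by simp
    also have "\<dots> \<le> (\<Sum>a\<in>UNIV. (?m a - \<rho> a / R) * \<bar>D a\<bar>)"
      by (rule order_trans[OF sum_abs]) (simp add: abs_mult abs_of_nonneg[OF nonneg])
    finally show ?thesis unfolding split .
  qed
  then have "(\<Sum>b\<in>UNIV. \<rho> b * \<bar>letter_sum D (subst_iter \<theta> e b)\<bar>)
      \<le> (\<Sum>b\<in>UNIV. \<rho> b * (letter_sum (\<lambda>a. \<bar>D a\<bar>) (subst_iter \<theta> e b) - ?N / R))"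
    by (intro sum_mono mult_left_mono) (auto simp: less_imp_le[OF \<rho>_pos])
  also have "\<dots> = (\<Sum>b\<in>UNIV. \<rho> b * letter_sum (\<lambda>a. \<bar>D a\<bar>) (subst_iter \<theta> e b)) - R * (?N / R)"
    by (simp add: right_diff_distrib sum_subtractf sum_distrib_right sum_divide_distrib)
  also have "\<dots> = (\<Lambda> ^ e - 1) * ?N"
    using R_pos by (simp add: eigenvector_duality algebra_simps)
  finally show ?thesis .
qed

text \<open>
  By duality the lengths of the words \<open>\<theta>\<^sup>m(a)\<close> are of order \<open>\<Lambda>\<^sup>m\<close> on average over \<open>a\<close>. A word
  \<open>\<theta>\<^sup>m\<^sup>+\<^sup>e(b)\<close> contains \<open>\<theta>\<^sup>m(a)\<close> for every letter \<open>a\<close>, so it is at least as long as this average.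
\<close>

lemma growth:
  assumes pos: "\<And>a b. 1 \<le> count_list (subst_iter \<theta> e b) a"
  shows "\<Lambda> ^ m \<le> length (subst_iter \<theta> (m + e) b)"
proof -
  let ?l = "\<lambda>a. real (length (subst_iter \<theta> m a))"
  have "\<Lambda> ^ m * R = (\<Sum>a\<in>UNIV. \<rho> a * ?l a)"
    using eigenvector_duality[of "\<lambda>_. 1" m] by (simp add: length_eq_letter_sum)
  also have "\<dots> \<le> (\<Sum>a\<in>UNIV. R * (real (count_list (subst_iter \<theta> e b) a) * ?l a))"
  proof (intro sum_mono mult_mono)
    show "?l a \<le> real (count_list (subst_iter \<theta> e b) a) * ?l a" for a
      using pos[of b a] mult_right_mono[of 1 "real (count_list (subst_iter \<theta> e b) a)" "?l a"] by simp
  qed (auto simp: \<rho>_le_R less_imp_le[OF R_pos])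
  also have "\<dots> = R * real (length (subst_iter \<theta> (m + e) b))"
    by (simp only: subst_iter_add length_eq_letter_sum letter_sum_subst_word
        letter_sum_eq_sum_count[where w = "subst_iter \<theta> e b"] sum_distrib_left of_nat_id)
  finally show ?thesis using R_pos by (simp add: mult.commute)
qed

text \<open>
  The sums of \<open>D\<close> over \<open>\<theta>\<^sup>e\<^sup>n(b)\<close> grow at most like \<open>(\<Lambda>\<^sup>e - 1)\<^sup>n\<close> by iterated contraction, the lengths at least
  like \<open>\<Lambda>\<^sup>e\<^sup>n\<close>, so the quotient decays geometrically with ratio \<open>q = 1 - \<Lambda>\<^sup>-\<^sup>e\<close>.
\<close>

lemma zero_mean_image_small:
  fixes \<epsilon> :: real
  assumes zero: "(\<Sum>a\<in>UNIV. \<rho> a * D a) = 0" and "0 < \<epsilon>"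
  shows "\<exists>m. \<forall>b. \<bar>letter_sum D (subst_iter \<theta> m b)\<bar> \<le> \<epsilon> * length (subst_iter \<theta> m b)"
proof -
  obtain e where pos: "\<And>a b. 1 \<le> count_list (subst_iter \<theta> e b) a"
    by (rule positive_power) blast
  let ?N = "\<Sum>a\<in>UNIV. \<rho> a * \<bar>D a\<bar>" and ?L = "\<Lambda> ^ e"
  let ?D = "\<lambda>n b. letter_sum D (subst_iter \<theta> (e * n) b)"
  have L1: "1 \<le> ?L"
  proof -
    have "R * 1 \<le> (\<Sum>b\<in>UNIV. \<rho> b * real (length (subst_iter \<theta> e b)))"
      unfolding sum_distrib_right
      using iter_nonempty[of e] by (intro sum_mono mult_left_mono) (auto simp: less_imp_le[OF \<rho>_pos] Suc_le_eq)
    also have "\<dots> = ?L * R"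
      using eigenvector_duality[of "\<lambda>_. 1" e] by (simp add: length_eq_letter_sum)
    finally show ?thesis using R_pos by simp
  qed
  have norm: "(\<Sum>b\<in>UNIV. \<rho> b * \<bar>?D n b\<bar>) \<le> (?L - 1) ^ n * ?N" for n
  proof (induction n)
    case (Suc n)
    have *: "?D (Suc n) b = letter_sum (?D n) (subst_iter \<theta> e b)" for b
    proof -
      have "e * Suc n = e * n + e" by simp
      then show ?thesis by (simp only: subst_iter_add letter_sum_subst_word)
    qed
    have "(\<Sum>b\<in>UNIV. \<rho> b * \<bar>?D (Suc n) b\<bar>) \<le> (?L - 1) * (\<Sum>b\<in>UNIV. \<rho> b * \<bar>?D n b\<bar>)"
      unfolding * by (rule contraction[OF pos]) (simp add: eigenvector_duality zero)
    also have "\<dots> \<le> (?L - 1) * ((?L - 1) ^ n * ?N)"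
      using L1 by (intro mult_left_mono Suc) auto
    finally show ?case by simp
  qed simp
  define q where "q = (?L - 1) / ?L"
  have q: "0 \<le> q" "q < 1" using L1 by (auto simp: q_def)
  have "\<forall>\<^sub>F n in sequentially. \<forall>b. q ^ n * ((?L - 1) * ?N / \<rho> b) < \<epsilon>"
  proof (rule eventually_all_finite)
    fix b
    have "(\<lambda>n. q ^ n * ((?L - 1) * ?N / \<rho> b)) \<longlonglongrightarrow> 0 * ((?L - 1) * ?N / \<rho> b)"
      using q by (intro tendsto_mult tendsto_const LIMSEQ_power_zero) auto
    then show "\<forall>\<^sub>F n in sequentially. q ^ n * ((?L - 1) * ?N / \<rho> b) < \<epsilon>"
      using \<open>0 < \<epsilon>\<close> by (intro order_tendstoD(2)) auto
  qed
  then obtain n where n: "\<And>b. q ^ n * ((?L - 1) * ?N / \<rho> b) < \<epsilon>"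
    by (auto simp: eventually_sequentially)
  \<comment> \<open>The exponent is \<open>Suc n\<close> since \<open>growth\<close> costs one factor of the positive power.\<close>
  have "\<bar>?D (Suc n) b\<bar> \<le> \<epsilon> * length (subst_iter \<theta> (e * Suc n) b)" for b
  proof -
    have "\<rho> b * \<bar>?D (Suc n) b\<bar> \<le> (\<Sum>b\<in>UNIV. \<rho> b * \<bar>?D (Suc n) b\<bar>)"
      by (rule member_le_sum) (auto simp: less_imp_le[OF \<rho>_pos])
    also have "\<dots> \<le> (?L - 1) ^ Suc n * ?N" by (rule norm)
    also have "\<dots> = (?L - 1) * ?N * (q ^ n * ?L ^ n)"
      using \<Lambda>_pos by (simp add: q_def power_divide)
    finally have "\<bar>?D (Suc n) b\<bar> \<le> q ^ n * ((?L - 1) * ?N / \<rho> b) * ?L ^ n"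
      using \<rho>_pos[of b] by (simp add: field_simps)
    also have "\<dots> \<le> \<epsilon> * length (subst_iter \<theta> (e * Suc n) b)"
    proof (rule mult_mono)
      have "\<Lambda> ^ (e * n) \<le> length (subst_iter \<theta> (e * n + e) b)" by (rule growth[OF pos])
      then show "?L ^ n \<le> length (subst_iter \<theta> (e * Suc n) b)"
        by (simp add: power_mult add.commute)
    qed (use n[of b] \<open>0 < \<epsilon>\<close> \<Lambda>_pos in auto)
    finally show ?thesis .
  qed
  then show ?thesis by blast
qed

end


section \<open>Desubstitution of infinite words\<close>

text \<open>
  When no \<open>\<sigma> a\<close> is empty, this says that \<open>u\<close> is the image of \<open>v\<close> under \<open>\<sigma>\<close>. Expressed through prefixes,
  the composition of two such relations is immediate.
\<close>

definition desubstitution :: "('a \<Rightarrow> 'a list) \<Rightarrow> 'a stream \<Rightarrow> 'a stream \<Rightarrow> bool" where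
  "desubstitution \<sigma> v u \<longleftrightarrow>
     (\<forall>j. stake (length (subst_word \<sigma> (stake j v))) u = subst_word \<sigma> (stake j v))"

lemma desubstitution_compose:
  assumes "desubstitution \<sigma> v u" "desubstitution \<tau> w v"
  shows "desubstitution (\<lambda>a. subst_word \<sigma> (\<tau> a)) w u"
  unfolding desubstitution_def
proof
  fix j
  let ?x = "subst_word \<tau> (stake j w)"
  have "stake (length ?x) v = ?x" using assms(2) by (simp add: desubstitution_def)
  moreover have "stake (length (subst_word \<sigma> (stake (length ?x) v))) u
      = subst_word \<sigma> (stake (length ?x) v)"
    using assms(1) unfolding desubstitution_def by blast
  ultimately show "stake (length (subst_word (\<lambda>a. subst_word \<sigma> (\<tau> a)) (stake j w))) u
      = subst_word (\<lambda>a. subst_word \<sigma> (\<tau> a)) (stake j w)"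
    by (simp add: subst_word_subst_word)
qed

lemma desubstitution_subst_stream:
  assumes "\<And>a. \<theta> a \<noteq> []"
  shows "desubstitution \<theta> v (subst_stream \<theta> v)"
proof -
  have "subst_stream \<theta> v = subst_word \<theta> (stake j v) @- subst_stream \<theta> (sdrop j v)" for j
  proof (induction j arbitrary: v)
    case (Suc j)
    have "subst_stream \<theta> v = \<theta> (shd v) @- subst_stream \<theta> (stl v)"
      unfolding subst_stream_def using assms by (subst flat_unfold) auto
    with Suc[of "stl v"] show ?case by simp
  qed simp
  then have "stake (length (subst_word \<theta> (stake j v))) (subst_stream \<theta> v) = subst_word \<theta> (stake j v)" for j
    using stake_shift[of "length (subst_word \<theta> (stake j v))" "subst_word \<theta> (stake j v)"]
    by (metis append.right_neutral diff_self_eq_0 stake.simps(1) take_all_iff le_refl)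
  then show ?thesis by (simp add: desubstitution_def)
qed

lemma length_subst_word_stake:
  "length (subst_word \<sigma> (stake j v)) = (\<Sum>i<j. length (\<sigma> (v !! i)))"
  by (induction j) (simp_all add: stake_Suc del: stake.simps(2))

lemma stake_desubstitution:
  assumes "desubstitution \<sigma> v u" and "r \<le> length (\<sigma> (v !! j))"
  shows "stake ((\<Sum>i<j. length (\<sigma> (v !! i))) + r) u
    = subst_word \<sigma> (stake j v) @ take r (\<sigma> (v !! j))"
proof -
  let ?L = "\<Sum>i<j. length (\<sigma> (v !! i))"
  have "stake (length (subst_word \<sigma> (stake (Suc j) v))) u = subst_word \<sigma> (stake (Suc j) v)"
    using assms(1) unfolding desubstitution_def by blast
  then have "stake (?L + length (\<sigma> (v !! j))) u = subst_word \<sigma> (stake j v) @ \<sigma> (v !! j)"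
    unfolding length_subst_word_stake by (simp add: stake_Suc del: stake.simps(2))
  then have "take (?L + r) (stake (?L + length (\<sigma> (v !! j))) u)
      = take (?L + r) (subst_word \<sigma> (stake j v) @ \<sigma> (v !! j))"
    by simp
  then show ?thesis
    using assms(2) by (simp add: take_stake min_def flip: length_subst_word_stake)
qed

text \<open>
  Positions are grouped into consecutive blocks of lengths \<open>l 0, l 1, \<dots>\<close>; every position lies in exactly
  one block, since no block is empty.
\<close>

lemma block_decomposition:
  fixes l :: "nat \<Rightarrow> nat"
  assumes "\<And>j. 0 < l j"
  obtains J r where "N = (\<Sum>i<J. l i) + r" "r < l J" "J \<le> N"
proof -
  have "\<exists>J r. N = (\<Sum>i<J. l i) + r \<and> r < l J \<and> J \<le> N"
  proof (induction N)
    case 0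
    show ?case using assms[of 0] by (intro exI[of _ 0]) simp
  next
    case (Suc N)
    then obtain J r where *: "N = (\<Sum>i<J. l i) + r" "r < l J" "J \<le> N" by blast
    show ?case
    proof (cases "Suc r < l J")
      case True
      with * show ?thesis by (intro exI[of _ J] exI[of _ "Suc r"]) simp
    next
      case False
      with * assms[of "Suc J"] show ?thesis by (intro exI[of _ "Suc J"] exI[of _ 0]) simp
    qed
  qed
  then show ?thesis using that by blast
qed

text \<open>
  If each block sum of \<open>t\<close> is known up to an error proportional to the block length, then so is every
  initial sum, up to the bounded contribution of the last, incomplete block. The lemma is used with
  \<open>t\<close> a letter weight and \<open>e = 0\<close> to prove equidistribution, and with \<open>t\<close> the values of a test function
  to compare the empirical law with the limit law.
\<close>

lemma block_sum:
  fixes l :: "nat \<Rightarrow> nat" and t e :: "nat \<Rightarrow> real" and c \<epsilon> :: real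
  assumes l: "\<And>j. 0 < l j" "\<And>j. l j \<le> M" and t: "\<And>n. \<bar>t n\<bar> \<le> c" and "0 \<le> \<epsilon>"
    and block: "\<And>j. \<bar>(\<Sum>r<l j. t ((\<Sum>i<j. l i) + r)) - e j\<bar> \<le> \<epsilon> * l j"
  obtains J where "J \<le> N" "\<bar>(\<Sum>n<N. t n) - (\<Sum>j<J. e j)\<bar> \<le> \<epsilon> * N + c * M"
proof -
  let ?L = "\<lambda>j. \<Sum>i<j. l i"
  obtain J r where N: "N = ?L J + r" "r < l J" and J: "J \<le> N"
    by (rule block_decomposition[OF l(1)])
  have c: "0 \<le> c" using t[of 0] by linarith
  have full: "\<bar>(\<Sum>n<?L j. t n) - (\<Sum>i<j. e i)\<bar> \<le> \<epsilon> * ?L j" for j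
  proof (induction j)
    case (Suc j)
    have "(\<Sum>n<?L (Suc j). t n) = (\<Sum>n<?L j. t n) + (\<Sum>r<l j. t (?L j + r))"
      by (simp add: sum_lessThan_add)
    with Suc block[of j] show ?case by (simp add: distrib_left)
  qed simp
  have rest: "\<bar>\<Sum>k<r. t (?L J + k)\<bar> \<le> c * M"
  proof -
    have "\<bar>\<Sum>k<r. t (?L J + k)\<bar> \<le> (\<Sum>k<r. c)"
      by (rule order_trans[OF sum_abs]) (intro sum_mono t)
    also have "\<dots> = real r * c" by simp
    also have "\<dots> \<le> real M * c" using N(2) l(2)[of J] c by (intro mult_right_mono) auto
    finally show ?thesis by (simp add: mult.commute)
  qed
  have "(\<Sum>n<N. t n) = (\<Sum>n<?L J. t n) + (\<Sum>k<r. t (?L J + k))"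
    unfolding N(1) by (rule sum_lessThan_add)
  moreover have "\<epsilon> * ?L J \<le> \<epsilon> * N" using N(1) \<open>0 \<le> \<epsilon>\<close> by (intro mult_left_mono) auto
  ultimately have "\<bar>(\<Sum>n<N. t n) - (\<Sum>j<J. e j)\<bar> \<le> \<epsilon> * N + c * M"
    using full[of J] rest by linarith
  with J show ?thesis by (rule that)
qed

text \<open>
  If \<open>\<theta>\<^sup>k(u) = u\<close>, then \<open>u\<close> is the image under \<open>\<theta>\<close> of \<open>\<theta>\<^sup>k\<^sup>-\<^sup>1(u)\<close>, which is again fixed by \<open>\<theta>\<^sup>k\<close>. Thus \<open>u\<close> can be
  desubstituted any number of times.
\<close>

lemma (in primitive_substitution) fixed_point_desubstitution:
  assumes "fixed_point \<theta> u"
  shows "\<exists>v. fixed_point \<theta> v \<and> desubstitution (subst_iter \<theta> m) v u"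
proof (induction m)
  case 0
  have "subst_word (subst_iter \<theta> 0) w = w" for w by (induction w) auto
  then show ?case using assms by (auto simp: desubstitution_def)
next
  case (Suc m)
  then obtain v where v: "fixed_point \<theta> v" "desubstitution (subst_iter \<theta> m) v u" by blast
  then obtain k where k: "0 < k" "(subst_stream \<theta> ^^ k) v = v" by (auto simp: fixed_point_def)
  let ?v = "(subst_stream \<theta> ^^ (k - 1)) v"
  have "subst_stream \<theta> ?v = v"
    using k by (cases k) auto
  moreover have "(subst_stream \<theta> ^^ k) ?v = ?v"
    using k(2) by (metis add.commute comp_apply funpow_add)
  ultimately have "fixed_point \<theta> ?v" "desubstitution \<theta> ?v v"
    using k(1) desubstitution_subst_stream[of \<theta> ?v] nonempty by (auto simp: fixed_point_def)
  moreover have "(\<lambda>a. subst_word (subst_iter \<theta> m) (\<theta> a)) = subst_iter \<theta> (Suc m)"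
    by (rule ext) simp
  ultimately show ?case using desubstitution_compose[OF v(2), of \<theta> ?v] by auto
qed


section \<open>Equidistribution of the letters of a fixed point\<close>

context primitive_substitution
begin

text \<open>
  Equidistribution of the letters of a fixed point, with frequencies proportional to \<open>\<rho>\<close>, in dual form:
  weights of mean zero have sublinear prefix sums. It follows by cutting the fixed point into blocks
  \<open>\<theta>\<^sup>m(b)\<close>, on each of which the weights nearly cancel.
\<close>

lemma zero_mean_prefix_sums:
  fixes \<epsilon> :: real
  assumes zero: "(\<Sum>a\<in>UNIV. \<rho> a * D a) = 0" and u: "fixed_point \<theta> u" and "0 < \<epsilon>"
  shows "\<exists>C. \<forall>N. \<bar>\<Sum>n<N. D (u !! n)\<bar> \<le> \<epsilon> * N + C"
proof -
  obtain m where m: "\<And>b. \<bar>letter_sum D (subst_iter \<theta> m b)\<bar> \<le> \<epsilon> * length (subst_iter \<theta> m b)"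
    using zero_mean_image_small[OF zero \<open>0 < \<epsilon>\<close>] by blast
  let ?\<sigma> = "subst_iter \<theta> m"
  obtain v where v: "desubstitution ?\<sigma> v u"
    using fixed_point_desubstitution[OF u] by blast
  let ?l = "\<lambda>j. length (?\<sigma> (v !! j))"
  have letter: "u !! ((\<Sum>i<j. ?l i) + r) = ?\<sigma> (v !! j) ! r" if "r < ?l j" for j r
  proof -
    have "stake ((\<Sum>i<j. ?l i) + Suc r) u ! ((\<Sum>i<j. ?l i) + r) = ?\<sigma> (v !! j) ! r"
      unfolding stake_desubstitution[OF v, of "Suc r" j, OF Suc_leI[OF that]]
      using that by (simp add: nth_append length_subst_word_stake)
    then show ?thesis by (simp del: stake.simps add: stake_nth)
  qed
  have "\<bar>\<Sum>n<N. D (u !! n)\<bar> \<le> \<epsilon> * N + (\<Sum>a\<in>UNIV. \<bar>D a\<bar>) * (\<Sum>b\<in>UNIV. length (?\<sigma> b))" for N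
  proof (rule block_sum[where l = ?l and e = "\<lambda>_. 0" and t = "\<lambda>n. D (u !! n)"])
    show "0 < ?l j" for j using iter_nonempty by simp
    show "?l j \<le> (\<Sum>b\<in>UNIV. length (?\<sigma> b))" for j by (rule member_le_sum) auto
    show "\<bar>D (u !! n)\<bar> \<le> (\<Sum>a\<in>UNIV. \<bar>D a\<bar>)" for n by (rule member_le_sum) auto
    show "\<bar>(\<Sum>r<?l j. D (u !! ((\<Sum>i<j. ?l i) + r))) - 0\<bar> \<le> \<epsilon> * ?l j" for j
      using m[of "v !! j"] by (simp add: letter sum_over_word)
  qed (use \<open>0 < \<epsilon>\<close> in auto)
  then show ?thesis by blast
qed

end


section \<open>Sums of a contracting eigenfunction over prefixes\<close>

lemma word_sum_append: "word_sum f (v @ w) = word_sum f v + word_sum f w"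
  by (simp add: word_sum_def)

locale contracting_eigenfunction = primitive_substitution +
  fixes f :: "'a \<Rightarrow> complex" and \<mu> :: complex
  assumes left_eigen: "left_eigenfunction \<theta> \<mu> f" and contracting: "cmod \<mu> < 1"
begin

lemma word_sum_iter: "word_sum f (subst_iter \<theta> m b) = \<mu> ^ m * f b"
proof (induction m arbitrary: b)
  case 0
  show ?case by (simp add: word_sum_def)
next
  case (Suc m)
  have "word_sum f (subst_iter \<theta> (Suc m) b) = letter_sum (\<lambda>a. \<mu> ^ m * f a) (\<theta> b)"
    using Suc by (simp add: word_sum_def letter_sum_subst_word del: map_map cong: map_cong)
  also have "\<dots> = \<mu> ^ m * (\<Sum>a\<in>UNIV. f a * subst_matrix \<theta> $ a $ b)"
    unfolding letter_sum_mult_left by (simp add: letter_sum_eq_sum_count subst_matrix_def mult.commute)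
  also have "\<dots> = \<mu> ^ Suc m * f b"
    using left_eigen by (simp add: left_eigenfunction_def)
  finally show ?case .
qed

lemma word_sum_subst_word: "word_sum f (subst_word (subst_iter \<theta> m) w) = \<mu> ^ m * word_sum f w"
  using word_sum_iter[of m]
  by (simp add: word_sum_def letter_sum_subst_word letter_sum_mult_left)

lemma word_sum_image: "word_sum f (subst_word \<theta> w) = \<mu> * word_sum f w"
proof -
  have "subst_iter \<theta> 1 b = \<theta> b" for b
    using subst_iter_Suc_outer[of \<theta> 0 b] by simp
  then have "subst_iter \<theta> 1 = \<theta>" by (rule ext)
  with word_sum_subst_word[of 1 w] show ?thesis by simp
qed

text \<open>
  A common bound for the values of \<open>f\<close> and for its sums over prefixes of the words \<open>\<theta> a\<close>. A sum instead of
  a maximum keeps the estimates simple.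
\<close>

definition "letter_bound =
  (\<Sum>a\<in>UNIV. cmod (f a) + (\<Sum>n\<le>length (\<theta> a). cmod (word_sum f (take n (\<theta> a)))))"

lemma letter_le: "cmod (f a) \<le> letter_bound"
proof -
  have "cmod (f a) \<le> cmod (f a) + (\<Sum>n\<le>length (\<theta> a). cmod (word_sum f (take n (\<theta> a))))"
    by (simp add: sum_nonneg)
  also have "\<dots> \<le> letter_bound"
    unfolding letter_bound_def by (rule member_le_sum) (auto intro!: add_nonneg_nonneg sum_nonneg)
  finally show ?thesis .
qed

lemma word_sum_prefix_le: "cmod (word_sum f (take n (\<theta> a))) \<le> letter_bound"
proof -
  let ?g = "\<lambda>a. \<Sum>n\<le>length (\<theta> a). cmod (word_sum f (take n (\<theta> a)))"
  have "take n (\<theta> a) = take (min n (length (\<theta> a))) (\<theta> a)" by (simp add: min_def)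
  then have "cmod (word_sum f (take n (\<theta> a))) \<le> ?g a"
    by (simp only:) (rule member_le_sum, auto)
  also have "\<dots> \<le> cmod (f a) + ?g a" by simp
  also have "\<dots> \<le> letter_bound"
    unfolding letter_bound_def by (rule member_le_sum) (auto intro!: add_nonneg_nonneg sum_nonneg)
  finally show ?thesis .
qed

text \<open>
  The fixed point of \<open>x \<mapsto> \<bar>\<mu>\<bar> x + letter_bound\<close>: every level of desubstitution multiplies the contribution
  of the complete blocks by \<open>\<mu>\<close> and adds one prefix of some \<open>\<theta> a\<close>. All prefix sums below, and the values of
  \<open>W\<close>, lie in the disc of this radius.
\<close>

definition "radius = letter_bound / (1 - cmod \<mu>)"

lemma radius: "cmod \<mu> * radius + letter_bound = radius" "0 \<le> radius" "0 \<le> letter_bound"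
proof -
  show l: "0 \<le> letter_bound" by (simp add: letter_bound_def sum_nonneg)
  show "cmod \<mu> * radius + letter_bound = radius" "0 \<le> radius"
    using contracting l by (simp_all add: radius_def field_simps)
qed

lemma word_sum_take_iter_le: "cmod (word_sum f (take r (subst_iter \<theta> m b))) \<le> radius"
proof (induction m arbitrary: r)
  case 0
  have "letter_bound \<le> radius"
    using radius(1) mult_nonneg_nonneg[OF norm_ge_zero[of \<mu>] radius(2)] by linarith
  moreover have "cmod (word_sum f (take r [b])) \<le> letter_bound"
    using letter_le[of b] radius(3) by (cases r) (auto simp: word_sum_def)
  ultimately show ?case by simp
next
  case (Suc m)
  obtain j n c where "take r (subst_word \<theta> (subst_iter \<theta> m b))
      = subst_word \<theta> (take j (subst_iter \<theta> m b)) @ take n (\<theta> c)"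
    using take_subst_word[of r \<theta> "subst_iter \<theta> m b"] by (elim exE) (rule that)
  then have "word_sum f (take r (subst_iter \<theta> (Suc m) b))
      = \<mu> * word_sum f (take j (subst_iter \<theta> m b)) + word_sum f (take n (\<theta> c))"
    unfolding subst_iter_Suc_outer by (simp add: word_sum_append word_sum_image)
  also have "cmod \<dots> \<le> cmod \<mu> * radius + letter_bound"
    by (intro norm_triangle_mono word_sum_prefix_le) (simp add: norm_mult mult_left_mono Suc)
  finally show ?case unfolding radius(1) .
qed

text \<open>
  The key identity: up to the complete blocks, whose contribution carries the small factor \<open>\<mu>\<^sup>m\<close>, a prefix
  sum of the fixed point depends only on the position inside the last block \<open>\<theta>\<^sup>m(b)\<close>.
\<close>

lemma prefix_sum_split:
  assumes "desubstitution (subst_iter \<theta> m) v u" "r \<le> length (subst_iter \<theta> m (v !! j))"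
  shows "word_sum f (stake ((\<Sum>i<j. length (subst_iter \<theta> m (v !! i))) + r) u)
    = \<mu> ^ m * word_sum f (stake j v) + word_sum f (take r (subst_iter \<theta> m (v !! j)))"
  using stake_desubstitution[OF assms] by (simp add: word_sum_append word_sum_subst_word)

lemma word_sum_le_length: "cmod (word_sum f w) \<le> length w * letter_bound"
proof (induction w)
  case (Cons a w)
  have "cmod (word_sum f (a # w)) \<le> cmod (f a) + cmod (word_sum f w)"
    unfolding word_sum_def by (simp add: norm_triangle_ineq)
  with Cons letter_le[of a] show ?case by (simp add: algebra_simps)
qed (simp add: word_sum_def)

text \<open>
  After \<open>m\<close> desubstitutions the number of complete blocks is at most \<open>n\<close>, so their contribution, of order
  \<open>\<bar>\<mu>\<bar>\<^sup>m n\<close>, disappears as \<open>m\<close> tends to infinity.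
\<close>

lemma prefix_sum_bounded:
  assumes u: "fixed_point \<theta> u"
  shows "cmod (word_sum f (stake n u)) \<le> radius"
proof (rule LIMSEQ_le_const)
  show "(\<lambda>m. cmod \<mu> ^ m * (n * letter_bound) + radius) \<longlonglongrightarrow> radius"
    using contracting by (auto intro!: tendsto_eq_intros LIMSEQ_power_zero)
  have "cmod (word_sum f (stake n u)) \<le> cmod \<mu> ^ m * (n * letter_bound) + radius" for m
  proof -
    obtain v where v: "desubstitution (subst_iter \<theta> m) v u"
      using fixed_point_desubstitution[OF u] by blast
    obtain J r where n: "n = (\<Sum>i<J. length (subst_iter \<theta> m (v !! i))) + r"
      "r < length (subst_iter \<theta> m (v !! J))" "J \<le> n"
      by (rule block_decomposition[of "\<lambda>i. length (subst_iter \<theta> m (v !! i))" n])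
         (simp add: iter_nonempty, assumption)
    have "cmod (word_sum f (stake J v)) \<le> J * letter_bound"
      using word_sum_le_length[of "stake J v"] by simp
    also have "\<dots> \<le> n * letter_bound"
      using n(3) radius(3) by (intro mult_right_mono) auto
    finally have J: "cmod (word_sum f (stake J v)) \<le> n * letter_bound" .
    have "word_sum f (stake n u)
        = \<mu> ^ m * word_sum f (stake J v) + word_sum f (take r (subst_iter \<theta> m (v !! J)))"
      using prefix_sum_split[OF v less_imp_le[OF n(2)]] by (simp only: n(1)[symmetric])
    also have "cmod \<dots> \<le> cmod \<mu> ^ m * (n * letter_bound) + radius"
      by (intro norm_triangle_mono word_sum_take_iter_le) (simp add: norm_mult norm_power mult_left_mono J)
    finally show ?thesis .
  qed
  then show "\<exists>N. \<forall>m\<ge>N. cmod (word_sum f (stake n u)) \<le> cmod \<mu> ^ m * (n * letter_bound) + radius"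
    by (intro exI[of _ 0] allI impI)
qed

end


section \<open>Finite paths\<close>

text \<open>
  The addresses of the positions in the word \<open>\<theta>\<^sup>m(c)\<close>, from the lowest level to the highest: the last
  state is a position in \<open>\<theta> c\<close>, and the states before it address a position in the \<open>(m - 1)\<close>-st iterate
  of the letter found there.
\<close>

primrec paths :: "('a \<Rightarrow> 'a list) \<Rightarrow> nat \<Rightarrow> 'a \<Rightarrow> ('a \<times> nat) list set" where
  "paths \<theta> 0 c = {[]}"
| "paths \<theta> (Suc m) c = (\<Union>k<length (\<theta> c). (\<lambda>ys. ys @ [(c, Suc k)]) ` paths \<theta> m (\<theta> c ! k))"

lemma finite_paths: "finite (paths \<theta> m c)"
  by (induction m arbitrary: c) auto

lemma length_paths: "xs \<in> paths \<theta> m c \<Longrightarrow> length xs = m"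
  by (induction m arbitrary: xs c) auto

lemma paths_subset_states: "xs \<in> paths \<theta> m c \<Longrightarrow> set xs \<subseteq> states \<theta>"
  by (induction m arbitrary: xs c) (fastforce simp: states_def)+

lemma last_paths: "xs \<in> paths \<theta> (Suc m) c \<Longrightarrow> fst (last xs) = c"
  by auto

lemma sum_paths_Suc:
  fixes h :: "('a \<times> nat) list \<Rightarrow> 'c::comm_monoid_add"
  shows "(\<Sum>xs\<in>paths \<theta> (Suc m) c. h xs)
    = (\<Sum>k<length (\<theta> c). \<Sum>ys\<in>paths \<theta> m (\<theta> c ! k). h (ys @ [(c, Suc k)]))"
  unfolding paths.simps
  by (subst sum.UNION_disjoint) (auto simp: finite_paths sum.reindex inj_on_def)

text \<open>
  The induction runs over the letter that state \<open>i\<close> selects, as this makes sense for \<open>i = 0\<close> too; the last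
  step converts it to the letter of the last state.
\<close>

lemma stake_path_space:
  assumes "x \<in> path_space \<theta>"
  shows "stake (Suc m) x \<in> paths \<theta> (Suc m) (fst (x !! m))"
proof -
  have state: "\<exists>k<length (\<theta> (fst (x !! i))). snd (x !! i) = Suc k" for i
  proof -
    have "x !! i \<in> states \<theta>" using assms by (auto simp: path_space_def streams_iff_snth)
    then have "snd (x !! i) - 1 < length (\<theta> (fst (x !! i)))" "snd (x !! i) = Suc (snd (x !! i) - 1)"
      by (auto simp: states_def case_prod_unfold)
    then show ?thesis by blast
  qed
  have "stake i x \<in> paths \<theta> i (\<theta> (fst (x !! i)) ! (snd (x !! i) - 1))" for i
  proof (induction i)
    case (Suc i)
    obtain k where k: "k < length (\<theta> (fst (x !! i)))" "snd (x !! i) = Suc k" using state by blast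
    have "fst (x !! i) = \<theta> (fst (x !! Suc i)) ! (snd (x !! Suc i) - 1)"
      using assms by (simp add: path_space_def)
    moreover have "stake (Suc i) x \<in> paths \<theta> (Suc i) (fst (x !! i))"
      using Suc k unfolding stake_Suc by (auto simp: prod_eq_iff simp del: stake.simps intro!: bexI[of _ k])
    ultimately show ?case by (simp only:)
  qed simp
  note i = this[of m]
  obtain k where k: "k < length (\<theta> (fst (x !! m)))" "snd (x !! m) = Suc k" using state by blast
  show ?thesis
    using i k unfolding stake_Suc by (auto simp: prod_eq_iff simp del: stake.simps intro!: bexI[of _ k])
qed

text \<open>
  A partial sum of the series \<open>W\<close>, as a function of the finite segment of the path that determines it,
  so that its expectation becomes a finite sum over paths.
\<close>

definition path_sum :: "('a \<Rightarrow> 'a list) \<Rightarrow> ('a \<Rightarrow> complex) \<Rightarrow> complex \<Rightarrow> ('a \<times> nat) list \<Rightarrow> complex" where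
  "path_sum \<theta> f \<mu> xs =
     (\<Sum>i<length xs. \<mu> ^ i * word_sum f (take (snd (xs ! i) - 1) (\<theta> (fst (xs ! i)))))"

lemma path_sum_snoc:
  "path_sum \<theta> f \<mu> (xs @ [(c, Suc k)])
    = path_sum \<theta> f \<mu> xs + \<mu> ^ length xs * word_sum f (take k (\<theta> c))"
  by (simp add: path_sum_def nth_append)

text \<open>
  The path leading to a position in \<open>\<theta>\<^sup>m(c)\<close> is its hierarchical address, and the partial sum of \<open>W\<close> along
  that path is exactly the sum of \<open>f\<close> over the letters of \<open>\<theta>\<^sup>m(c)\<close> before that position. Stated for sums over
  all paths, this needs no explicit bijection.
\<close>

lemma (in contracting_eigenfunction) sum_over_paths:
  fixes h :: "complex \<Rightarrow> real"
  shows "(\<Sum>xs\<in>paths \<theta> m c. h (path_sum \<theta> f \<mu> xs))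
    = (\<Sum>r<length (subst_iter \<theta> m c). h (word_sum f (take r (subst_iter \<theta> m c))))"
proof (induction m arbitrary: c h)
  case 0
  show ?case by (simp add: path_sum_def word_sum_def)
next
  case (Suc m)
  have "(\<Sum>xs\<in>paths \<theta> (Suc m) c. h (path_sum \<theta> f \<mu> xs))
      = (\<Sum>k<length (\<theta> c). \<Sum>ys\<in>paths \<theta> m (\<theta> c ! k).
           h (path_sum \<theta> f \<mu> ys + \<mu> ^ m * word_sum f (take k (\<theta> c))))"
    unfolding sum_paths_Suc by (intro sum.cong refl) (simp add: path_sum_snoc length_paths)
  also have "\<dots> = (\<Sum>k<length (\<theta> c). \<Sum>r<length (subst_iter \<theta> m (\<theta> c ! k)).
      h (word_sum f (subst_word (subst_iter \<theta> m) (take k (\<theta> c)) @ take r (subst_iter \<theta> m (\<theta> c ! k)))))"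
    by (intro sum.cong refl Suc[THEN trans])
       (simp add: word_sum_append word_sum_subst_word add.commute)
  also have "\<dots> = (\<Sum>r<length (subst_iter \<theta> (Suc m) c). h (word_sum f (take r (subst_iter \<theta> (Suc m) c))))"
    unfolding subst_iter.simps by (rule sum_prefixes_subst_word[symmetric])
  finally show ?case .
qed


section \<open>Expectations under the Markov measure\<close>

context primitive_substitution
begin

lemma sum_states: "(\<Sum>y\<in>states \<theta>. \<rho> (fst y)) = \<Lambda> * R"
proof -
  have "states \<theta> = (SIGMA b:UNIV. {1..length (\<theta> b)})" by (auto simp: states_def)
  then have "(\<Sum>y\<in>states \<theta>. \<rho> (fst y)) = (\<Sum>b\<in>UNIV. \<Sum>k\<in>{1..length (\<theta> b)}. \<rho> b)"
    by (simp only: sum.Sigma finite finite_atLeastAtMost ball_UNIV simp_thms) (simp add: split_beta)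
  also have "\<dots> = (\<Sum>b\<in>UNIV. \<rho> b * length (\<theta> b))" by (simp add: mult.commute)
  also have "\<dots> = (\<Sum>b\<in>UNIV. \<rho> b * letter_sum (\<lambda>_. 1) (subst_iter \<theta> 1 b))"
    using subst_iter_Suc_outer[of \<theta> 0] by (simp add: length_eq_letter_sum)
  also have "\<dots> = \<Lambda> * R" unfolding eigenvector_duality by simp
  finally show ?thesis .
qed

text \<open>
  The quotients of values of \<open>\<rho>\<close> telescope, so that all paths with the same last letter are equally
  likely.
\<close>

lemma path_prob:
  assumes "xs \<in> paths \<theta> (Suc m) c"
  shows "init_prob \<theta> \<rho> (hd xs) * (\<Prod>i<m. trans_prob \<theta> \<rho> (xs ! i) (xs ! Suc i))
    = \<rho> c / (\<Lambda> ^ Suc m * R)"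
  using assms
proof (induction m arbitrary: xs c)
  case 0
  then show ?case by (auto simp: init_prob_def sum_states)
next
  case (Suc m)
  then obtain k ys where k: "k < length (\<theta> c)"
    and ys: "ys \<in> paths \<theta> (Suc m) (\<theta> c ! k)" and xs: "xs = ys @ [(c, Suc k)]"
    unfolding paths.simps(2)[of \<theta> "Suc m"] by blast
  have l: "length ys = Suc m" by (rule length_paths[OF ys])
  then have "ys \<noteq> []" by auto
  then have "fst (ys ! m) = \<theta> c ! k" using last_paths[OF ys] l by (simp add: last_conv_nth)
  then have step: "trans_prob \<theta> \<rho> (xs ! m) (xs ! Suc m) = \<rho> c / (\<Lambda> * \<rho> (\<theta> c ! k))"
    by (simp add: xs l nth_append trans_prob_def edge_def)
  have "init_prob \<theta> \<rho> (hd xs) * (\<Prod>i<Suc m. trans_prob \<theta> \<rho> (xs ! i) (xs ! Suc i))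
      = (init_prob \<theta> \<rho> (hd ys) * (\<Prod>i<m. trans_prob \<theta> \<rho> (ys ! i) (ys ! Suc i)))
          * trans_prob \<theta> \<rho> (xs ! m) (xs ! Suc m)"
    using l by (auto simp: xs nth_append hd_append intro!: prod.cong)
  also have "\<dots> = \<rho> (\<theta> c ! k) / (\<Lambda> ^ Suc m * R) * (\<rho> c / (\<Lambda> * \<rho> (\<theta> c ! k)))"
    unfolding step Suc.IH[OF ys] ..
  also have "\<dots> = \<rho> c / (\<Lambda> ^ Suc (Suc m) * R)"
    using \<rho>_pos[of "\<theta> c ! k"] by simp
  finally show ?case .
qed

lemma integral_MPM:
  fixes h :: "('a \<times> nat) list \<Rightarrow> real"
  shows "(\<integral>x. h (stake (Suc m) x) \<partial>MPM \<theta> \<rho>)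
    = (\<Sum>c\<in>UNIV. \<rho> c * (\<Sum>xs\<in>paths \<theta> (Suc m) c. h xs)) / (\<Lambda> ^ Suc m * R)"
proof -
  let ?N = "MPM \<theta> \<rho>" and ?E = "path_space \<theta>"
  let ?C = "stream_space (count_space (UNIV :: ('a \<times> nat) set))"
  have "markov_law ?E (states \<theta>) (init_prob \<theta> \<rho>) (trans_prob \<theta> \<rho>) ?N"
    by (rule markov_law_MPM[OF prim eigvec])
  then have N: "prob_space ?N" "space ?N = ?E" "sets ?N = sets (restrict_space ?C ?E)"
    and cyl: "\<And>xs. xs \<noteq> [] \<Longrightarrow> set xs \<subseteq> states \<theta> \<Longrightarrow> measure ?N {x \<in> ?E. stake (length xs) x = xs} =
        init_prob \<theta> \<rho> (hd xs) * (\<Prod>i<length xs - 1. trans_prob \<theta> \<rho> (xs ! i) (xs ! Suc i))"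
    unfolding markov_law_def by blast+
  interpret N: prob_space ?N by (rule N(1))
  let ?A = "\<lambda>xs. {x \<in> ?E. stake (Suc m) x = xs}"
  let ?U = "\<Union>c. paths \<theta> (Suc m) c"
  have A: "?A xs \<in> sets ?N" for xs
  proof -
    have "{x \<in> space ?C. stake (Suc m) x = xs} \<in> sets ?C" by measurable
    then have "?E \<inter> {x \<in> space ?C. stake (Suc m) x = xs} \<in> sets (restrict_space ?C ?E)"
      by (auto simp: sets_restrict_space)
    moreover have "?E \<inter> {x \<in> space ?C. stake (Suc m) x = xs} = ?A xs"
      by (auto simp: space_stream_space)
    ultimately show ?thesis unfolding N(3) by (simp only:)
  qed
  have U: "finite ?U" by (intro finite_UN_I finite_paths) auto
  have prob: "measure ?N (?A xs) = \<rho> c / (\<Lambda> ^ Suc m * R)" if "xs \<in> paths \<theta> (Suc m) c" for xs c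
    using cyl[of xs] that length_paths[OF that] paths_subset_states[OF that] path_prob[OF that]
    by auto
  have "(\<integral>x. h (stake (Suc m) x) \<partial>?N) = (\<integral>x. (\<Sum>xs\<in>?U. h xs * indicat_real (?A xs) x) \<partial>?N)"
  proof (rule Bochner_Integration.integral_cong[OF refl])
    fix x assume "x \<in> space ?N"
    then have x: "x \<in> ?E" by (simp add: N(2))
    have "(\<Sum>xs\<in>?U. h xs * indicat_real (?A xs) x) = (\<Sum>xs\<in>{stake (Suc m) x}. h xs)"
      using U stake_path_space[OF x, of m] x
      by (intro sum.mono_neutral_cong_right) (auto simp del: stake.simps paths.simps simp: indicator_def)
    then show "h (stake (Suc m) x) = (\<Sum>xs\<in>?U. h xs * indicat_real (?A xs) x)" by simp
  qed
  also have "\<dots> = (\<Sum>xs\<in>?U. h xs * measure ?N (?A xs))"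
  proof (subst Bochner_Integration.integral_sum)
    show "integrable ?N (\<lambda>x. h xs * indicat_real (?A xs) x)" for xs
      by (intro integrable_mult_right integrable_real_indicator A) (simp add: N.emeasure_eq_measure)
    have "?A xs \<inter> space ?N = ?A xs" for xs using A by (rule sets.Int_space_eq2)
    then show "(\<Sum>xs\<in>?U. \<integral>x. h xs * indicat_real (?A xs) x \<partial>?N) = (\<Sum>xs\<in>?U. h xs * measure ?N (?A xs))"
      by (simp only: integral_mult_right_zero Bochner_Integration.integral_indicator)
  qed
  also have "\<dots> = (\<Sum>c\<in>UNIV. \<Sum>xs\<in>paths \<theta> (Suc m) c. h xs * measure ?N (?A xs))"
  proof (intro sum.UNION_disjoint ballI impI finite_paths)
    fix c d :: 'a
    assume "c \<noteq> d"
    then show "paths \<theta> (Suc m) c \<inter> paths \<theta> (Suc m) d = {}"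
      using last_paths[of _ \<theta> m c] last_paths[of _ \<theta> m d] by (auto simp del: paths.simps)
  qed simp
  also have "\<dots> = (\<Sum>c\<in>UNIV. \<Sum>xs\<in>paths \<theta> (Suc m) c. h xs * (\<rho> c / (\<Lambda> ^ Suc m * R)))"
    by (intro sum.cong refl arg_cong2[where f = "(*)"] prob)
  also have "\<dots> = (\<Sum>c\<in>UNIV. \<rho> c * (\<Sum>xs\<in>paths \<theta> (Suc m) c. h xs)) / (\<Lambda> ^ Suc m * R)"
    by (simp only: sum_distrib_left sum_divide_distrib mult_ac times_divide_eq_right)
  finally show ?thesis .
qed

end


section \<open>Convergence of the averages\<close>

context contracting_eigenfunction
begin

lemma summable_W_terms:
  "summable (\<lambda>i. \<mu> ^ i * word_sum f (take (snd (x !! i) - 1) (\<theta> (fst (x !! i)))))"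
  by (rule summable_norm_cancel) (rule summable_W[OF contracting])

lemma W_truncation:
  "cmod (W \<theta> f \<mu> x - path_sum \<theta> f \<mu> (stake m x)) \<le> cmod \<mu> ^ m * radius"
proof -
  let ?t = "\<lambda>i. \<mu> ^ i * word_sum f (take (snd (x !! i) - 1) (\<theta> (fst (x !! i))))"
  have "path_sum \<theta> f \<mu> (stake m x) = (\<Sum>i<m. ?t i)"
    by (simp add: path_sum_def del: stake.simps)
  then have "W \<theta> f \<mu> x - path_sum \<theta> f \<mu> (stake m x) = (\<Sum>i. ?t (i + m))"
    using suminf_split_initial_segment[OF summable_W_terms[of x], of m] by (simp add: W_def)
  also have "cmod \<dots> \<le> (\<Sum>i. cmod \<mu> ^ m * letter_bound * cmod \<mu> ^ i)"
  proof (rule norm_suminf_le)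
    show "cmod (?t (i + m)) \<le> cmod \<mu> ^ m * letter_bound * cmod \<mu> ^ i" for i
      using mult_left_mono[OF word_sum_prefix_le, of "cmod \<mu> ^ (i + m)"]
      by (simp add: norm_mult norm_power power_add mult_ac)
    show "summable (\<lambda>i. cmod \<mu> ^ m * letter_bound * cmod \<mu> ^ i)"
      using contracting by (intro summable_mult summable_geometric) simp
  qed
  also have "\<dots> = cmod \<mu> ^ m * radius"
    using contracting by (subst suminf_mult) (auto simp: suminf_geometric radius_def summable_geometric)
  finally show ?thesis .
qed

lemma W_bounded: "cmod (W \<theta> f \<mu> x) \<le> radius"
  using W_truncation[of x 0] by (simp add: path_sum_def)

lemma path_sum_bounded: "cmod (path_sum \<theta> f \<mu> (stake m x)) \<le> 2 * radius"
proof -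
  have "cmod (path_sum \<theta> f \<mu> (stake m x))
      \<le> cmod (W \<theta> f \<mu> x) + cmod (W \<theta> f \<mu> x - path_sum \<theta> f \<mu> (stake m x))"
    using norm_triangle_sub[of "path_sum \<theta> f \<mu> (stake m x)" "W \<theta> f \<mu> x"]
    by (simp add: norm_minus_commute)
  also have "\<dots> \<le> radius + cmod \<mu> ^ m * radius" by (intro add_mono W_bounded W_truncation)
  also have "cmod \<mu> ^ m * radius \<le> 1 * radius"
    using contracting radius(2) by (intro mult_right_mono power_le_one) auto
  finally show ?thesis by simp
qed

lemma measurable_W_term:
  "(\<lambda>x. \<mu> ^ i * word_sum f (take (snd (x !! i) - 1) (\<theta> (fst (x !! i))))) \<in> borel_measurable (MPM \<theta> \<rho>)"
proof -
  let ?C = "stream_space (count_space (UNIV :: ('a \<times> nat) set))"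
  have sets: "sets (MPM \<theta> \<rho>) = sets (restrict_space ?C (path_space \<theta>))"
    using markov_law_MPM[OF prim eigvec] unfolding markov_law_def by blast
  have "(\<lambda>x. \<mu> ^ i * word_sum f (take (snd (x !! i) - 1) (\<theta> (fst (x !! i))))) \<in> borel_measurable ?C"
    by (rule measurable_compose[OF measurable_snth[of i]]) simp
  then show ?thesis
    unfolding measurable_cong_sets[OF sets refl] by (rule measurable_restrict_space1)
qed

lemma measurable_W: "W \<theta> f \<mu> \<in> borel_measurable (MPM \<theta> \<rho>)"
  unfolding W_def[abs_def] by (rule borel_measurable_suminf[OF measurable_W_term])

lemma measurable_path_sum: "(\<lambda>x. path_sum \<theta> f \<mu> (stake m x)) \<in> borel_measurable (MPM \<theta> \<rho>)"
proof -
  have "path_sum \<theta> f \<mu> (stake m x)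
      = (\<Sum>i<m. \<mu> ^ i * word_sum f (take (snd (x !! i) - 1) (\<theta> (fst (x !! i)))))" for x
    by (simp add: path_sum_def del: stake.simps)
  then show ?thesis by (simp only: borel_measurable_sum[OF measurable_W_term])
qed

text \<open>
  Fix \<open>m\<close> so large that \<open>\<bar>\<mu>\<bar>\<^sup>m\<close> is negligible for the test function \<open>g\<close>. Over a block \<open>\<theta>\<^sup>m(b)\<close> of the fixed point
  the values of \<open>g\<close> then sum to nearly the quantity \<open>F b\<close>, which depends only on \<open>b\<close>, and the expectation of
  \<open>g\<close> at the truncated series is the quotient \<open>Tm\<close> of the \<open>\<rho>\<close>-weighted sums of \<open>F b\<close> and of \<open>|\<theta>\<^sup>m(b)|\<close>.
  Hence \<open>F b - Tm |\<theta>\<^sup>m(b)|\<close> is a letter weight of mean zero, and its prefix sums over the desubstituted word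
  are sublinear.
\<close>

lemma average_deviation:
  fixes g :: "complex \<Rightarrow> real" and \<epsilon> :: real
  assumes u: "fixed_point \<theta> u" and cont: "continuous_on UNIV g" and "0 < \<epsilon>"
  shows "\<exists>C. \<forall>N. \<bar>\<Sum>n<N. g (word_sum f (stake n u)) - (\<integral>x. g (W \<theta> f \<mu> x) \<partial>MPM \<theta> \<rho>)\<bar> \<le> \<epsilon> * N + C"
proof -
  \<comment> \<open>Twice the radius, to contain the truncated series as well.\<close>
  let ?K = "cball (0::complex) (2 * radius)"
  let ?T = "\<integral>x. g (W \<theta> f \<mu> x) \<partial>MPM \<theta> \<rho>"
  interpret MPM: prob_space "MPM \<theta> \<rho>"
    using markov_law_MPM[OF prim eigvec] unfolding markov_law_def by blast
  \<comment> \<open>Three errors: within blocks, letter frequencies, and truncation of the series.\<close>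
  define \<eta> where "\<eta> = \<epsilon> / 3"
  have "0 < \<eta>" using \<open>0 < \<epsilon>\<close> by (simp add: \<eta>_def)
  have "uniformly_continuous_on ?K g"
    by (rule compact_uniformly_continuous[OF continuous_on_subset[OF cont]]) auto
  then obtain \<delta> where "0 < \<delta>"
    and \<delta>: "\<And>z z'. z \<in> ?K \<Longrightarrow> z' \<in> ?K \<Longrightarrow> dist z' z < \<delta> \<Longrightarrow> dist (g z') (g z) < \<eta>"
    using \<open>0 < \<eta>\<close> unfolding uniformly_continuous_on_def by metis
  have "\<forall>\<^sub>F m in sequentially. cmod \<mu> ^ m * radius < \<delta>"
  proof (rule order_tendstoD(2)[OF _ \<open>0 < \<delta>\<close>])
    show "(\<lambda>m. cmod \<mu> ^ m * radius) \<longlonglongrightarrow> 0"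
      using contracting by (auto intro!: tendsto_eq_intros LIMSEQ_power_zero)
  qed
  then obtain m0 where m0: "\<And>m. m \<ge> m0 \<Longrightarrow> cmod \<mu> ^ m * radius < \<delta>"
    by (auto simp: eventually_sequentially)
  \<comment> \<open>A successor, since the law of the chain is described by nonempty initial segments.\<close>
  define m where "m = Suc m0"
  have m: "cmod \<mu> ^ m * radius < \<delta>" unfolding m_def by (rule m0) simp
  have close: "\<bar>g z' - g z\<bar> \<le> \<eta>"
    if "cmod z \<le> 2 * radius" "cmod z' \<le> 2 * radius" "cmod (z' - z) \<le> cmod \<mu> ^ m * radius" for z z'
    using \<delta>[of z z'] that m by (auto simp: dist_norm intro!: less_imp_le)
  obtain B where B: "\<And>z. cmod z \<le> 2 * radius \<Longrightarrow> \<bar>g z\<bar> \<le> B"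
  proof -
    have "bounded (g ` ?K)"
      by (intro compact_imp_bounded compact_continuous_image continuous_on_subset[OF cont]) auto
    then obtain b where "\<forall>z\<in>?K. \<bar>g z\<bar> \<le> b" by (auto simp: bounded_iff)
    then show ?thesis by (intro that[of b]) simp
  qed
  define Tm where "Tm = (\<integral>x. g (path_sum \<theta> f \<mu> (stake m x)) \<partial>MPM \<theta> \<rho>)"
  have mg: "g \<in> borel_measurable borel"
    by (rule borel_measurable_continuous_onI[OF cont])
  have T: "\<bar>Tm - ?T\<bar> \<le> \<eta>"
  proof -
    let ?d = "\<lambda>x. g (path_sum \<theta> f \<mu> (stake m x)) - g (W \<theta> f \<mu> x)"
    have d: "\<bar>?d x\<bar> \<le> \<eta>" for x
      using W_truncation[of x m] W_bounded[of x] radius(2) path_sum_bounded[of m x]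
      by (intro close) (auto simp: norm_minus_commute)
    have int: "integrable (MPM \<theta> \<rho>) (\<lambda>x. g (path_sum \<theta> f \<mu> (stake m x)))"
      "integrable (MPM \<theta> \<rho>) (\<lambda>x. g (W \<theta> f \<mu> x))"
    proof -
      have "\<bar>g (W \<theta> f \<mu> x)\<bar> \<le> B" for x
        using W_bounded[of x] radius(2) by (intro B) simp
      then show "integrable (MPM \<theta> \<rho>) (\<lambda>x. g (W \<theta> f \<mu> x))"
        by (intro MPM.integrable_const_bound[of _ B] measurable_compose[OF measurable_W mg]) auto
      show "integrable (MPM \<theta> \<rho>) (\<lambda>x. g (path_sum \<theta> f \<mu> (stake m x)))"
        using B[OF path_sum_bounded]
        by (intro MPM.integrable_const_bound[of _ B] measurable_compose[OF measurable_path_sum mg]) auto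
    qed
    have "Tm - ?T = (\<integral>x. ?d x \<partial>MPM \<theta> \<rho>)"
      unfolding Tm_def by (rule Bochner_Integration.integral_diff[OF int, symmetric])
    moreover have "?d x \<le> \<eta>" "- \<eta> \<le> ?d x" for x using d[of x] by linarith+
    then have "(\<integral>x. ?d x \<partial>MPM \<theta> \<rho>) \<le> \<eta>" "- \<eta> \<le> (\<integral>x. ?d x \<partial>MPM \<theta> \<rho>)"
      by (intro MPM.integral_le_const MPM.integral_ge_const
          Bochner_Integration.integrable_diff int AE_I2; simp)+
    ultimately show ?thesis by linarith
  qed
  define F where "F b = (\<Sum>r<length (subst_iter \<theta> m b). g (word_sum f (take r (subst_iter \<theta> m b))))" for b
  define D where "D b = F b - Tm * length (subst_iter \<theta> m b)" for b
  have zero: "(\<Sum>b\<in>UNIV. \<rho> b * D b) = 0"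
  proof -
    have "Tm = (\<Sum>c\<in>UNIV. \<rho> c * F c) / (\<Lambda> ^ m * R)"
      using integral_MPM[where m = m0 and h = "\<lambda>xs. g (path_sum \<theta> f \<mu> xs)"]
      by (simp only: Tm_def m_def sum_over_paths F_def)
    moreover have "(\<Sum>b\<in>UNIV. \<rho> b * length (subst_iter \<theta> m b)) = \<Lambda> ^ m * R"
      using eigenvector_duality[of "\<lambda>_. 1" m] by (simp add: length_eq_letter_sum)
    then have "(\<Sum>b\<in>UNIV. \<rho> b * D b) = (\<Sum>c\<in>UNIV. \<rho> c * F c) - Tm * (\<Lambda> ^ m * R)"
      by (simp add: D_def right_diff_distrib sum_subtractf sum_distrib_left mult_ac flip: sum_distrib_left)
    ultimately show ?thesis using \<Lambda>_pos R_pos by simp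
  qed
  obtain v where v: "fixed_point \<theta> v" "desubstitution (subst_iter \<theta> m) v u"
    using fixed_point_desubstitution[OF u] by blast
  obtain C where C: "\<And>N. \<bar>\<Sum>n<N. D (v !! n)\<bar> \<le> \<eta> * N + C"
    using zero_mean_prefix_sums[OF zero v(1) \<open>0 < \<eta>\<close>] by blast
  let ?l = "\<lambda>j. length (subst_iter \<theta> m (v !! j))"
  let ?L = "\<lambda>j. \<Sum>i<j. ?l i"
  let ?t = "\<lambda>n. g (word_sum f (stake n u)) - Tm"
  let ?M = "\<Sum>b\<in>UNIV. length (subst_iter \<theta> m b)"
  have block: "\<bar>(\<Sum>r<?l j. ?t (?L j + r)) - D (v !! j)\<bar> \<le> \<eta> * ?l j" for j
  proof -
    let ?z = "\<lambda>r. word_sum f (take r (subst_iter \<theta> m (v !! j)))"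
    have "(\<Sum>r<?l j. ?t (?L j + r)) - D (v !! j)
        = (\<Sum>r<?l j. g (word_sum f (stake (?L j + r) u)) - g (?z r))"
      by (simp add: D_def F_def sum_subtractf)
    also have "\<bar>\<dots>\<bar> \<le> (\<Sum>r<?l j. \<eta>)"
    proof (rule order_trans[OF sum_abs], rule sum_mono)
      fix r assume r: "r \<in> {..<?l j}"
      show "\<bar>g (word_sum f (stake (?L j + r) u)) - g (?z r)\<bar> \<le> \<eta>"
      proof (rule close)
        show "cmod (?z r) \<le> 2 * radius"
          using word_sum_take_iter_le[of r m "v !! j"] radius(2) by linarith
        show "cmod (word_sum f (stake (?L j + r) u)) \<le> 2 * radius"
          using prefix_sum_bounded[OF u, of "?L j + r"] radius(2) by linarith
        have "word_sum f (stake (?L j + r) u) - ?z r = \<mu> ^ m * word_sum f (stake j v)"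
          using prefix_sum_split[OF v(2), of r j] r by simp
        then show "cmod (word_sum f (stake (?L j + r) u) - ?z r) \<le> cmod \<mu> ^ m * radius"
          using prefix_sum_bounded[OF v(1), of j]
          by (simp add: norm_mult norm_power mult_left_mono)
      qed
    qed
    finally show ?thesis by (simp add: mult.commute)
  qed
  have "\<bar>\<Sum>n<N. g (word_sum f (stake n u)) - ?T\<bar> \<le> \<epsilon> * N + (C + (B + \<bar>Tm\<bar>) * ?M)" for N
  proof -
    obtain J where J: "J \<le> N"
      "\<bar>(\<Sum>n<N. ?t n) - (\<Sum>j<J. D (v !! j))\<bar> \<le> \<eta> * N + (B + \<bar>Tm\<bar>) * ?M"
    proof (rule block_sum[where l = ?l and e = "\<lambda>j. D (v !! j)" and t = ?t and N = N
          and \<epsilon> = \<eta> and c = "B + \<bar>Tm\<bar>" and M = ?M])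
      show "0 < ?l j" for j using iter_nonempty by simp
      show "?l j \<le> ?M" for j by (rule member_le_sum) auto
      show "\<bar>?t n\<bar> \<le> B + \<bar>Tm\<bar>" for n
        using B[of "word_sum f (stake n u)"] prefix_sum_bounded[OF u, of n] radius(2) by linarith
      show "0 \<le> \<eta>" using \<open>0 < \<eta>\<close> by simp
    qed (rule block, rule that)
    have "(\<Sum>n<N. g (word_sum f (stake n u)) - ?T) = (\<Sum>n<N. ?t n) + N * (Tm - ?T)"
      by (simp add: sum_subtractf algebra_simps)
    moreover have "\<bar>N * (Tm - ?T)\<bar> \<le> \<eta> * N"
      using mult_left_mono[OF T, of "real N"] by (simp add: abs_mult mult.commute)
    moreover have "\<eta> * J \<le> \<eta> * N" using J(1) \<open>0 < \<eta>\<close> by simp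
    moreover have "\<epsilon> * N = 3 * (\<eta> * N)" by (simp add: \<eta>_def)
    ultimately show ?thesis using J(2) C[of J] by linarith
  qed
  then show ?thesis by blast
qed

lemma averages_converge:
  fixes g :: "complex \<Rightarrow> real"
  assumes u: "fixed_point \<theta> u" and cont: "continuous_on UNIV g"
  shows "(\<lambda>N. (\<Sum>n=1..N. g (word_sum f (stake n u))) / N) \<longlonglongrightarrow> (\<integral>x. g (W \<theta> f \<mu> x) \<partial>MPM \<theta> \<rho>)"
proof (rule LIMSEQ_I)
  let ?T = "\<integral>x. g (W \<theta> f \<mu> x) \<partial>MPM \<theta> \<rho>" and ?s = "\<lambda>n. g (word_sum f (stake n u))"
  fix \<epsilon> :: real assume "0 < \<epsilon>"
  then obtain C where C: "\<And>N. \<bar>\<Sum>n<N. ?s n - ?T\<bar> \<le> \<epsilon> / 2 * N + C"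
    using average_deviation[OF u cont, of "\<epsilon> / 2"] by auto
  \<comment> \<open>Passing from the positions \<open>0, \<dots>, N\<close> to \<open>1, \<dots>, N\<close> drops the term at \<open>0\<close>.\<close>
  let ?C = "\<epsilon> / 2 + C + \<bar>?s 0 - ?T\<bar>"
  have *: "\<bar>\<Sum>n=1..N. ?s n - ?T\<bar> \<le> \<epsilon> / 2 * N + ?C" for N
  proof -
    have "(\<Sum>n<Suc N. ?s n - ?T) = (?s 0 - ?T) + (\<Sum>n=1..N. ?s n - ?T)"
      by (simp only: sum.lessThan_Suc_shift sum.atLeast1_atMost_eq One_nat_def)
    moreover have "\<epsilon> / 2 * Suc N = \<epsilon> / 2 * N + \<epsilon> / 2" by (simp add: algebra_simps)
    ultimately show ?thesis using C[of "Suc N"] by linarith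
  qed
  obtain N0 :: nat where N0: "?C / (\<epsilon> / 2) < N0" using reals_Archimedean2 by blast
  show "\<exists>N0. \<forall>N\<ge>N0. norm ((\<Sum>n=1..N. ?s n) / N - ?T) < \<epsilon>"
  proof (intro exI[of _ "Suc N0"] allI impI)
    fix N assume N: "Suc N0 \<le> N"
    then have "?C / (\<epsilon> / 2) < N" using N0 by linarith
    then have "?C < \<epsilon> / 2 * N" using \<open>0 < \<epsilon>\<close> by (simp add: field_simps)
    then have "\<bar>\<Sum>n=1..N. ?s n - ?T\<bar> < \<epsilon> * N" using *[of N] by linarith
    moreover have "(\<Sum>n=1..N. ?s n) / N - ?T = (\<Sum>n=1..N. ?s n - ?T) / N"
      using N by (simp add: sum_subtractf diff_divide_distrib)
    ultimately show "norm ((\<Sum>n=1..N. ?s n) / N - ?T) < \<epsilon>"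
      using N by (simp add: divide_less_eq)
  qed
qed

end

theorem theorem3p1:
  fixes \<theta> :: "'a::finite \<Rightarrow> 'a list" and u :: "'a stream"
    and f :: "'a \<Rightarrow> complex" and \<mu> :: complex and \<rho> :: "'a \<Rightarrow> real"
    and P :: "nat \<Rightarrow> 'p measure" and K :: "nat \<Rightarrow> 'p \<Rightarrow> nat"
    and Q :: "'q measure" and X :: "'q \<Rightarrow> ('a \<times> nat) stream"
  assumes "primitive_subst \<theta>"
    and "fixed_point \<theta> u"
    and "left_eigenfunction \<theta> \<mu> f" and "cmod \<mu> < 1"
    and "pf_right_eigenvector \<theta> \<rho>"
    and "\<And>N. N \<ge> 1 \<Longrightarrow> prob_space (P N)"
    and "\<And>N. N \<ge> 1 \<Longrightarrow> K N \<in> measurable (P N) (count_space UNIV)"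
    and "\<And>N. N \<ge> 1 \<Longrightarrow> distr (P N) (count_space UNIV) (K N) = measure_pmf (pmf_of_set {1..N})"
    and "prob_space Q"
    and "X \<in> measurable Q (MPM \<theta> \<rho>)"
    and "distr Q (MPM \<theta> \<rho>) X = MPM \<theta> \<rho>"
  shows "converges_in_distribution P (\<lambda>N \<omega>. word_sum f (stake (K N \<omega>) u))
           Q (\<lambda>\<omega>. W \<theta> f \<mu> (X \<omega>))"
proof -
  interpret contracting_eigenfunction \<theta> \<rho> f \<mu>
    by unfold_locales (use assms in auto)
  show ?thesis
    unfolding converges_in_distribution_def
  proof (intro conjI allI impI)
    have "(\<lambda>\<omega>. word_sum f (stake (K N \<omega>) u)) \<in> borel_measurable (P N)" if "N \<ge> 1" for N
      by (rule measurable_compose[OF assms(7)[OF that]]) simp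
    then show "\<forall>\<^sub>F N in sequentially. (\<lambda>\<omega>. word_sum f (stake (K N \<omega>) u)) \<in> borel_measurable (P N)"
      unfolding eventually_sequentially by blast
    show "(\<lambda>\<omega>. W \<theta> f \<mu> (X \<omega>)) \<in> borel_measurable Q"
      by (rule measurable_compose[OF assms(10) measurable_W])
  next
    fix g :: "complex \<Rightarrow> real"
    assume g: "continuous_on UNIV g \<and> bounded (range g)"
    then have mg: "g \<in> borel_measurable borel"
      by (intro borel_measurable_continuous_onI) simp
    let ?s = "\<lambda>n. g (word_sum f (stake n u))"
    have "(\<integral>\<omega>. g (W \<theta> f \<mu> (X \<omega>)) \<partial>Q) = (\<integral>x. g (W \<theta> f \<mu> x) \<partial>distr Q (MPM \<theta> \<rho>) X)"
      by (rule integral_distr[symmetric, OF assms(10)]) (rule measurable_compose[OF measurable_W mg])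
    then have limit: "(\<integral>\<omega>. g (W \<theta> f \<mu> (X \<omega>)) \<partial>Q) = (\<integral>x. g (W \<theta> f \<mu> x) \<partial>MPM \<theta> \<rho>)"
      unfolding assms(11) .
    have average: "(\<integral>\<omega>. ?s (K N \<omega>) \<partial>P N) = (\<Sum>n=1..N. ?s n) / N" if N: "N \<ge> 1" for N
    proof -
      have "(\<integral>\<omega>. ?s (K N \<omega>) \<partial>P N) = (\<integral>n. ?s n \<partial>distr (P N) (count_space UNIV) (K N))"
        by (rule integral_distr[symmetric, OF assms(7)[OF N]]) simp
      also have "\<dots> = (\<Sum>n=1..N. ?s n) / N"
        unfolding assms(8)[OF N] using N by (subst integral_pmf_of_set) auto
      finally show ?thesis .
    qed
    have "(\<lambda>N. (\<Sum>n=1..N. ?s n) / N) \<longlonglongrightarrow> (\<integral>x. g (W \<theta> f \<mu> x) \<partial>MPM \<theta> \<rho>)"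
      using g by (intro averages_converge assms(2)) simp
    then show "(\<lambda>N. \<integral>\<omega>. ?s (K N \<omega>) \<partial>P N) \<longlonglongrightarrow> (\<integral>\<omega>. g (W \<theta> f \<mu> (X \<omega>)) \<partial>Q)"
      unfolding limit
    proof (rule Lim_transform_eventually)
      show "\<forall>\<^sub>F N in sequentially. (\<Sum>n=1..N. ?s n) / N = (\<integral>\<omega>. ?s (K N \<omega>) \<partial>P N)"
        unfolding eventually_sequentially using average by (intro exI[of _ 1]) auto
    qed
  qed
qed

end
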